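(* Let $f=f^*\in A_\Theta^\infty$ with $n=4$, and let $$R=\sum_{i=1}^4\Big(-3e^{-2f}\,\delta_i^2(e^f)+\tfrac32 e^{-2f}\,\delta_i(e^f)\,e^{-f}\,\delta_i(e^f)\Big)$$ be the scalar curvature of the noncommutative four-torus with the conformally flat metric $g_{ij}=e^f\delta_{ij}$. Then $$R=-3e^{-f}K(\nabla)\Big(\sum_{i=1}^4\delta_i^2(f)\Big)+3e^{-f}H(\nabla,\nabla)\Big(\sum_{i=1}^4\delta_i(f)^2\Big),$$ where $$K(s)=\frac{e^s-1}{s},\qquad H(s,t)=\frac{s(e^t-1)(-3e^s-1)+t(e^s-1)(e^t+3)}{2st(s+t)}.$$
   Context: Let $\Theta=(\theta_{jk})$ be a real skew-symmetric $4\times4$ matrix. $A_\Theta$ is the universal unital $C^*$-algebra generated by unitaries $U_1,\dots,U_4$ with $U_jU_k=e^{2\pi i\theta_{jk}}U_kU_j$; $A_\Theta^\infty=\{\sum_{k\in\mathbb Z^4}a_kU_1^{k_1}\cdots U_4^{k_4}: (a_k)\text{ rapidly decreasing}\}$. The canonical derivations $\delta_j$ (also written $\partial_j$) of $A_\Theta^\infty$ are determined by $\delta_j(U_k)=2\pi i\,\delta_{jk}U_k$. $\nabla=\log\Delta:=-\mathrm{ad}_f$, i.e. $\nabla(x)=-[f,x]=xf-fx$, so $\Delta(x)=e^{-f}xe^{f}$. $K$ and $H$ extend to entire functions (removable singularities). $K(\nabla)$ is defined by the power series of $K$. If $H(s,t)=\sum_{m,n}c_{mn}s^mt^n$, then $H(\nabla,\nabla)(ab)$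 denotes $\sum_{m,n}c_{mn}\nabla^m(a)\nabla^n(b)$, i.e. the first variable acts on the first factor and the second variable on the second factor; $H(\nabla,\nabla)(\sum_i\delta_i(f)^2)$ means $\sum_iH(\nabla,\nabla)(\delta_i(f)\,\delta_i(f))$ in this sense. *)

theory Defs
  imports "HOL-Analysis.Analysis" "HOL-Algebra.Module"
begin

section \<open>C*-algebras\<close>

text \<open>
  Unital C*-algebras as a type class, so that the library exponential \<^term>\<open>exp\<close> and
  summation in Banach spaces apply. The superclass \<^class>\<open>real_normed_algebra_1\<close> contains
  \<open>norm 1 = 1\<close>, so the algebra is non-zero.
\<close>

class cstar_algebra = real_normed_algebra_1 + banach +
  fixes scaleC :: "complex \<Rightarrow> 'a \<Rightarrow> 'a"  (infixr "*\<^sub>C" 75)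
    and star :: "'a \<Rightarrow> 'a"
  assumes scaleR_scaleC: "r *\<^sub>R x = complex_of_real r *\<^sub>C x"
    and scaleC_add_right: "c *\<^sub>C (x + y) = c *\<^sub>C x + c *\<^sub>C y"
    and scaleC_add_left: "(c + d) *\<^sub>C x = c *\<^sub>C x + d *\<^sub>C x"
    and scaleC_scaleC: "c *\<^sub>C d *\<^sub>C x = (c * d) *\<^sub>C x"
    and mult_scaleC_left: "(c *\<^sub>C x) * y = c *\<^sub>C (x * y)"
    and mult_scaleC_right: "x * (c *\<^sub>C y) = c *\<^sub>C (x * y)"
    and norm_scaleC: "norm (c *\<^sub>C x) = cmod c * norm x"
    and star_star: "star (star x) = x"
    and star_add: "star (x + y) = star x + star y"
    and star_scaleC: "star (c *\<^sub>C x) = cnj c *\<^sub>C star x"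
    and star_mult: "star (x * y) = star y * star x"
    and cstar_identity: "norm (star x * x) = (norm x)\<^sup>2"

text \<open>
  A universal property quantifies over all C*-algebras, hence inside a formula; for this purpose
  C*-algebras are also given as records with an explicit carrier.
\<close>

record 'b cstar_rec = "(complex, 'b) module" +
  adj :: "'b \<Rightarrow> 'b"
  nrm :: "'b \<Rightarrow> real"

locale unital_cstar = ring B for B :: "('b, 'm) cstar_rec_scheme" (structure) +
  assumes smult_closed: "x \<in> carrier B \<Longrightarrow> c \<odot> x \<in> carrier B"
    and smult_add_right: "\<lbrakk>x \<in> carrier B; y \<in> carrier B\<rbrakk> \<Longrightarrow> c \<odot> (x \<oplus> y) = c \<odot> x \<oplus> c \<odot> y"
    and smult_add_left: "x \<in> carrier B \<Longrightarrow> (c + d) \<odot> x = c \<odot> x \<oplus> d \<odot> x"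
    and smult_smult: "x \<in> carrier B \<Longrightarrow> c \<odot> (d \<odot> x) = (c * d) \<odot> x"
    and smult_one: "x \<in> carrier B \<Longrightarrow> 1 \<odot> x = x"
    and mult_smult_left: "\<lbrakk>x \<in> carrier B; y \<in> carrier B\<rbrakk> \<Longrightarrow> (c \<odot> x) \<otimes> y = c \<odot> (x \<otimes> y)"
    and mult_smult_right: "\<lbrakk>x \<in> carrier B; y \<in> carrier B\<rbrakk> \<Longrightarrow> x \<otimes> (c \<odot> y) = c \<odot> (x \<otimes> y)"
    and nrm_nonneg: "x \<in> carrier B \<Longrightarrow> 0 \<le> nrm B x"
    and nrm_eq_0: "x \<in> carrier B \<Longrightarrow> nrm B x = 0 \<longleftrightarrow> x = \<zero>"
    and nrm_triangle: "\<lbrakk>x \<in> carrier B; y \<in> carrier B\<rbrakk> \<Longrightarrow> nrm B (x \<oplus> y) \<le> nrm B x + nrm B y"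
    and nrm_smult: "x \<in> carrier B \<Longrightarrow> nrm B (c \<odot> x) = cmod c * nrm B x"
    and nrm_mult: "\<lbrakk>x \<in> carrier B; y \<in> carrier B\<rbrakk> \<Longrightarrow> nrm B (x \<otimes> y) \<le> nrm B x * nrm B y"
    and complete: "Metric_space.mcomplete (carrier B) (\<lambda>x y. nrm B (x \<ominus> y))"
    and adj_closed: "x \<in> carrier B \<Longrightarrow> adj B x \<in> carrier B"
    and adj_adj: "x \<in> carrier B \<Longrightarrow> adj B (adj B x) = x"
    and adj_add: "\<lbrakk>x \<in> carrier B; y \<in> carrier B\<rbrakk> \<Longrightarrow> adj B (x \<oplus> y) = adj B x \<oplus> adj B y"
    and adj_smult: "x \<in> carrier B \<Longrightarrow> adj B (c \<odot> x) = cnj c \<odot> adj B x"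
    and adj_mult: "\<lbrakk>x \<in> carrier B; y \<in> carrier B\<rbrakk> \<Longrightarrow> adj B (x \<otimes> y) = adj B y \<otimes> adj B x"
    and nrm_cstar: "x \<in> carrier B \<Longrightarrow> nrm B (adj B x \<otimes> x) = (nrm B x)\<^sup>2"

definition unital_star_hom ::
    "('b, 'm) cstar_rec_scheme \<Rightarrow> ('a::cstar_algebra \<Rightarrow> 'b) \<Rightarrow> bool" where
  "unital_star_hom B \<phi> \<longleftrightarrow>
     (\<forall>x. \<phi> x \<in> carrier B) \<and>
     (\<forall>x y. \<phi> (x + y) = \<phi> x \<oplus>\<^bsub>B\<^esub> \<phi> y) \<and>
     (\<forall>c x. \<phi> (c *\<^sub>C x) = c \<odot>\<^bsub>B\<^esub> \<phi> x) \<and>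
     (\<forall>x y. \<phi> (x * y) = \<phi> x \<otimes>\<^bsub>B\<^esub> \<phi> y) \<and>
     \<phi> 1 = \<one>\<^bsub>B\<^esub> \<and>
     (\<forall>x. \<phi> (star x) = adj B (\<phi> x))"


section \<open>The noncommutative four-torus\<close>

text \<open>
  Generators are indexed by the four-element numeral type \<^typ>\<open>4\<close>; its elements are
  1, 2, 3 and 4 (which equals 0).
\<close>

definition torus_unitaries :: "real^4^4 \<Rightarrow> (4 \<Rightarrow> 'a::cstar_algebra) \<Rightarrow> bool" where
  "torus_unitaries \<Theta> U \<longleftrightarrow>
     (\<forall>j. star (U j) * U j = 1 \<and> U j * star (U j) = 1) \<and>
     (\<forall>j k. U j * U k = exp (2 * pi * \<i> * \<Theta> $ j $ k) *\<^sub>C (U k * U j))"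

definition torus_unitaries_in ::
    "('b, 'm) cstar_rec_scheme \<Rightarrow> real^4^4 \<Rightarrow> (4 \<Rightarrow> 'b) \<Rightarrow> bool" where
  "torus_unitaries_in B \<Theta> V \<longleftrightarrow>
     (\<forall>j. V j \<in> carrier B \<and> adj B (V j) \<otimes>\<^bsub>B\<^esub> V j = \<one>\<^bsub>B\<^esub> \<and> V j \<otimes>\<^bsub>B\<^esub> adj B (V j) = \<one>\<^bsub>B\<^esub>) \<and>
     (\<forall>j k. V j \<otimes>\<^bsub>B\<^esub> V k = exp (2 * pi * \<i> * \<Theta> $ j $ k) \<odot>\<^bsub>B\<^esub> (V k \<otimes>\<^bsub>B\<^esub> V j))"

definition closed_star_subalgebra :: "'a::cstar_algebra set \<Rightarrow> bool" where
  "closed_star_subalgebra S \<longleftrightarrow> closed S \<and> 1 \<in> S \<and>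
     (\<forall>x\<in>S. \<forall>y\<in>S. x + y \<in> S \<and> x * y \<in> S) \<and> (\<forall>c. \<forall>x\<in>S. c *\<^sub>C x \<in> S) \<and> (\<forall>x\<in>S. star x \<in> S)"

text \<open>
  \<open>is_nc_torus \<Theta> U\<close>: the whole type is the universal unital C*-algebra generated by the
  unitaries \<open>U\<close> subject to the relations given by \<open>\<Theta>\<close>. The test algebras have carriers in
  \<^typ>\<open>nat \<Rightarrow> complex\<close>, a type with continuum many elements. This is no loss: the closed
  subalgebra generated by four unitaries is separable, hence has at most continuum many elements,
  and so is isomorphic to one with such a carrier.
\<close>

definition is_nc_torus :: "real^4^4 \<Rightarrow> (4 \<Rightarrow> 'a::cstar_algebra) \<Rightarrow> bool" where
  "is_nc_torus \<Theta> U \<longleftrightarrow>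
     torus_unitaries \<Theta> U \<and>
     (\<forall>S. closed_star_subalgebra S \<and> range U \<subseteq> S \<longrightarrow> S = UNIV) \<and>
     (\<forall>(B :: (nat \<Rightarrow> complex) cstar_rec) V. unital_cstar B \<and> torus_unitaries_in B \<Theta> V \<longrightarrow>
        (\<exists>!\<phi>. unital_star_hom B \<phi> \<and> (\<forall>j. \<phi> (U j) = V j)))"

text \<open>Integer powers of a unitary: its inverse is its adjoint.\<close>

definition upow :: "'a::cstar_algebra \<Rightarrow> int \<Rightarrow> 'a" where
  "upow u n = (if 0 \<le> n then u ^ nat n else star u ^ nat (- n))"

definition torus_monomial :: "(4 \<Rightarrow> 'a::cstar_algebra) \<Rightarrow> int^4 \<Rightarrow> 'a" where
  "torus_monomial U k = upow (U 1) (k $ 1) * upow (U 2) (k $ 2) * upow (U 3) (k $ 3) * upow (U 4) (k $ 4)"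

definition fourier :: "(4 \<Rightarrow> 'a::cstar_algebra) \<Rightarrow> (int^4 \<Rightarrow> complex) \<Rightarrow> 'a" where
  "fourier U a = (\<Sum>\<^sub>\<infinity>k. a k *\<^sub>C torus_monomial U k)"

definition decay_weight :: "nat \<Rightarrow> (int^4 \<Rightarrow> complex) \<Rightarrow> int^4 \<Rightarrow> real" where
  "decay_weight N a k = (1 + (\<Sum>j\<in>UNIV. \<bar>real_of_int (k $ j)\<bar>)) ^ N * cmod (a k)"

definition rapidly_decreasing :: "(int^4 \<Rightarrow> complex) \<Rightarrow> bool" where
  "rapidly_decreasing a \<longleftrightarrow> (\<forall>N. bdd_above (range (decay_weight N a)))"

definition decay_seminorm :: "nat \<Rightarrow> (int^4 \<Rightarrow> complex) \<Rightarrow> real" where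
  "decay_seminorm N a = (SUP k. decay_weight N a k)"

definition smooth_torus :: "(4 \<Rightarrow> 'a::cstar_algebra) \<Rightarrow> 'a set" where
  "smooth_torus U = fourier U ` {a. rapidly_decreasing a}"

text \<open>
  The values on the generators determine a derivation of the smooth algebra among those that are
  continuous for its Frechet topology, which is the topology of the seminorms above on the
  coefficients. Continuity is only required with respect to the C*-norm on the target, a weaker condition.
  Values outside the smooth algebra are irrelevant.
\<close>

definition canonical_derivation ::
    "(4 \<Rightarrow> 'a::cstar_algebra) \<Rightarrow> 4 \<Rightarrow> ('a \<Rightarrow> 'a) \<Rightarrow> bool" where
  "canonical_derivation U j D \<longleftrightarrow>
     (\<forall>x\<in>smooth_torus U. D x \<in> smooth_torus U) \<and>
     (\<forall>x\<in>smooth_torus U. \<forall>y\<in>smooth_torus U. D (x + y) = D x + D y) \<and>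
     (\<forall>c. \<forall>x\<in>smooth_torus U. D (c *\<^sub>C x) = c *\<^sub>C D x) \<and>
     (\<forall>x\<in>smooth_torus U. \<forall>y\<in>smooth_torus U. D (x * y) = D x * y + x * D y) \<and>
     (\<exists>N C. \<forall>a. rapidly_decreasing a \<longrightarrow> norm (D (fourier U a)) \<le> C * decay_seminorm N a) \<and>
     (\<forall>k. D (U k) = (if j = k then (2 * pi * \<i>) *\<^sub>C U k else 0))"


section \<open>Scalar curvature and functional calculus of the modular derivation\<close>

definition scalar_curvature :: "(4 \<Rightarrow> 'a::cstar_algebra \<Rightarrow> 'a) \<Rightarrow> 'a \<Rightarrow> 'a" where
  "scalar_curvature \<delta> f =
     (\<Sum>i\<in>UNIV. - 3 * exp (- 2 * f) * \<delta> i (\<delta> i (exp f))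
               + (3/2) *\<^sub>R (exp (- 2 * f) * \<delta> i (exp f) * exp (- f) * \<delta> i (exp f)))"

definition nabla :: "'a::cstar_algebra \<Rightarrow> 'a \<Rightarrow> 'a" where
  "nabla f x = - (f * x - x * f)"

definition K_fun :: "complex \<Rightarrow> complex" where
  "K_fun s = (exp s - 1) / s"

definition H_fun :: "complex \<Rightarrow> complex \<Rightarrow> complex" where
  "H_fun s t =
     (s * (exp t - 1) * (- 3 * exp s - 1) + t * (exp s - 1) * (exp t + 3)) / (2 * s * t * (s + t))"

text \<open>
  The Taylor coefficients of the entire extensions: the power series converges everywhere and
  agrees with the formula wherever its denominator does not vanish (elsewhere the formula has the
  junk value 0).
\<close>

definition K_coeff :: "nat \<Rightarrow> complex" where
  "K_coeff = (THE c. \<forall>s. s \<noteq> 0 \<longrightarrow> (\<lambda>n. c n * s ^ n) sums K_fun s)"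

definition H_coeff :: "nat \<Rightarrow> nat \<Rightarrow> complex" where
  "H_coeff = (THE c. \<forall>s t. s \<noteq> 0 \<and> t \<noteq> 0 \<and> s + t \<noteq> 0 \<longrightarrow>
     ((\<lambda>(m, n). c m n * s ^ m * t ^ n) has_sum H_fun s t) UNIV)"

definition K_nabla :: "'a::cstar_algebra \<Rightarrow> 'a \<Rightarrow> 'a" where
  "K_nabla f x = (\<Sum>n. K_coeff n *\<^sub>C (nabla f ^^ n) x)"

text \<open>\<open>H_nabla f a b\<close> is \<open>H(\<nabla>,\<nabla>)(ab)\<close>; it depends on the pair of factors, not on their product.\<close>

definition H_nabla :: "'a::cstar_algebra \<Rightarrow> 'a \<Rightarrow> 'a \<Rightarrow> 'a" where
  "H_nabla f a b = (\<Sum>\<^sub>\<infinity>(m, n). H_coeff m n *\<^sub>C ((nabla f ^^ m) a * (nabla f ^^ n) b))"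

end

theory Submission
  imports Defs
begin

text \<open>
  Fix a derivation \<open>D = \<delta> i\<close> and write \<open>a = D f\<close>, \<open>b = D (D f)\<close>. The curvature only involves
  \<open>D (exp f)\<close> and \<open>D (D (exp f))\<close>, and the claim is that, after \<open>exp f\<close> has been pulled out to the
  left, both are functions of \<open>\<nabla>\<close> applied to \<open>a\<close> and \<open>b\<close>:
  \<open>D (exp f) = exp f * K(\<nabla>) a\<close> and \<open>D (D (exp f)) = exp f * (K(\<nabla>) b + 2 L(\<nabla>,\<nabla>)(a a))\<close>, where
  \<open>L(s,t)\<close> is the integral of \<open>e^(q s + p t)\<close> over \<open>0 \<le> p \<le> q \<le> 1\<close>, which equals
  \<open>(K(s + t) - K(s)) / t\<close>. These are Duhamel's formulas. Substituting them gives
  \<open>-3 e^(-f) K(\<nabla>) b + e^(-f) (-6 L + 3/2 K K)(\<nabla>,\<nabla>)(a a)\<close> for the \<open>i\<close>-th summand of the curvature, and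
  \<open>H(s,t) = K(s) K(t) / 2 - 2 L(s,t)\<close> is an identity of functions (\<open>H_fun_decomposition\<close>).

  Duhamel's formulas are proved with formal power series in a central variable \<open>X\<close>, without
  integrals. There \<open>exp(X f)\<close> solves \<open>Y' = f Y\<close>, and \<open>exp(-X f) x exp(X f) = exp(X \<nabla>) x\<close>. So
  \<open>D (exp(X f))\<close> and \<open>D (D (exp(X f)))\<close> solve inhomogeneous linear equations, whose solution by
  variation of constants is \<open>exp(X f)\<close> times iterated formal antiderivatives of \<open>exp(X \<nabla>) a\<close> and
  \<open>exp(X \<nabla>) b\<close> (\<open>second_derivative_of_exp_fps\<close>). All series converge absolutely at \<open>X = 1\<close>, and their
  values there are read off from the coefficients (\<open>derivatives_of_exp_sums\<close>, \<open>H_nabla_eq\<close>).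

  The remaining point is that \<open>D\<close>, which is only controlled on smooth elements, may be applied
  twice to the exponential series term by term. Monomials multiply up to a phase, hence absolutely
  summable families of multiples of monomials can be multiplied and regrouped, and powers
  of a rapidly decreasing sequence of coefficients grow at most geometrically in each weighted
  \<open>\<ell>\<^sup>1\<close> norm. So \<open>exp f\<close> is smooth. By the Leibniz rule and continuity, \<open>D\<close> multiplies the \<open>k\<close>-th
  Fourier coefficient by \<open>2 \<pi> \<i> k\<^sub>j\<close> (\<open>derivation_fourier\<close>), and a multiplier of polynomial growth
  commutes with the summation of the series (\<open>derivatives_of_exp_termwise\<close>).
\<close>

section \<open>Derivatives of the exponential as formal power series\<close>

text \<open>
  The antiderivative with constant term 0. At degree 0 the index \<open>n - 1\<close> is junk, but the factor
  \<open>1 / 0 = 0\<close> removes it.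
\<close>

definition fps_antideriv :: "'a::real_algebra_1 fps \<Rightarrow> 'a fps" where
  "fps_antideriv Y = Abs_fps (\<lambda>n. fps_nth Y (n - 1) /\<^sub>R real n)"

definition exp_fps :: "'a::real_algebra_1 \<Rightarrow> 'a fps" where
  "exp_fps f = Abs_fps (\<lambda>n. f ^ n /\<^sub>R fact n)"

text \<open>
  The series \<open>exp(X \<nabla>) x\<close>. The name refers to its other description \<open>exp(-X f) x exp(X f)\<close>, which is
  the content of \<open>exp_fps_conj_fps\<close> below.
\<close>

definition conj_fps :: "'a::cstar_algebra \<Rightarrow> 'a \<Rightarrow> 'a fps" where
  "conj_fps f x = Abs_fps (\<lambda>n. (nabla f ^^ n) x /\<^sub>R fact n)"

lemma of_nat_mult_scaleR: "of_nat n * (x::'a::real_algebra_1) = real n *\<^sub>R x"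
  by (metis mult_scaleR_left of_real_def of_real_of_nat_eq mult_1)

lemma fps_deriv_antideriv:
  fixes Y :: "'a::real_algebra_1 fps"
  shows "fps_deriv (fps_antideriv Y) = Y"
  by (rule fps_ext) (simp add: fps_antideriv_def of_nat_mult_scaleR[where 'a = 'a] del: of_nat_Suc of_nat_add)

lemma fps_antideriv_nth_0 [simp]: "fps_nth (fps_antideriv Y) 0 = 0"
  by (simp add: fps_antideriv_def)

text \<open>
  Comparing coefficients of \<open>X^n\<close> determines the coefficient of degree \<open>n + 1\<close> from the one of
  degree \<open>n\<close>, because \<open>n + 1\<close> is invertible in a real algebra. Coefficients on both sides of the
  unknown are needed because the algebra is not commutative.
\<close>

lemma fps_linear_ode_unique:
  fixes Y W Z :: "'a::real_algebra_1 fps"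
  assumes Y: "fps_deriv Y = fps_const f * Y + Y * fps_const h + Z"
    and W: "fps_deriv W = fps_const f * W + W * fps_const h + Z"
    and 0: "fps_nth Y 0 = fps_nth W 0"
  shows "Y = W"
proof (rule fps_ext)
  show "fps_nth Y n = fps_nth W n" for n
  proof (induction n)
    case (Suc n)
    have "of_nat (n + 1) * fps_nth Y (n + 1) = of_nat (n + 1) * fps_nth W (n + 1)"
      using arg_cong[OF Y, of "\<lambda>F. fps_nth F n"] arg_cong[OF W, of "\<lambda>F. fps_nth F n"] Suc
      by simp
    then have "real (n + 1) *\<^sub>R fps_nth Y (Suc n) = real (n + 1) *\<^sub>R fps_nth W (Suc n)"
      unfolding of_nat_mult_scaleR by simp
    then show ?case
      by (simp del: of_nat_Suc of_nat_add)
  qed (fact 0)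
qed

lemma fps_deriv_scaled_by_fact:
  fixes d :: "nat \<Rightarrow> 'a::real_algebra_1"
  shows "fps_deriv (Abs_fps (\<lambda>n. d n /\<^sub>R fact n)) = Abs_fps (\<lambda>n. d (Suc n) /\<^sub>R fact n)"
proof (rule fps_ext)
  fix n
  have "inverse (fact (Suc n)) * real (Suc n) = inverse (fact n)"
    by (simp add: field_simps del: of_nat_Suc)
  then show "fps_nth (fps_deriv (Abs_fps (\<lambda>n. d n /\<^sub>R fact n))) n
      = fps_nth (Abs_fps (\<lambda>n. d (Suc n) /\<^sub>R fact n)) n"
    by (simp add: of_nat_mult_scaleR[where 'a = 'a] del: of_nat_Suc of_nat_add fact_Suc)
qed

lemma fps_deriv_exp_fps:
  "fps_deriv (exp_fps f) = fps_const f * exp_fps f"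
  "fps_deriv (exp_fps f) = exp_fps f * fps_const f"
  unfolding exp_fps_def fps_deriv_scaled_by_fact
  by (auto intro!: fps_ext simp: fps_eq_iff power_commutes)

lemma fps_deriv_conj_fps:
  "fps_deriv (conj_fps f x) = conj_fps f x * fps_const f - fps_const f * conj_fps f x"
  unfolding conj_fps_def fps_deriv_scaled_by_fact
  by (auto intro!: fps_ext simp: nabla_def algebra_simps)

text \<open>
  Both sides solve \<open>Y' = Y f\<close> with \<open>Y(0) = x\<close>: on the left the derivative of \<open>exp(X f)\<close> cancels the
  term \<open>- f x\<close> of \<open>\<nabla>\<close>.
\<close>

lemma exp_fps_conj_fps: "exp_fps f * conj_fps f x = fps_const x * exp_fps f"
proof (rule fps_linear_ode_unique)
  show "fps_deriv (exp_fps f * conj_fps f x)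
      = fps_const 0 * (exp_fps f * conj_fps f x) + exp_fps f * conj_fps f x * fps_const f + 0"
    by (simp add: fps_deriv_exp_fps(2) fps_deriv_conj_fps algebra_simps)
  show "fps_deriv (fps_const x * exp_fps f)
      = fps_const 0 * (fps_const x * exp_fps f) + fps_const x * exp_fps f * fps_const f + 0"
    by (simp add: fps_deriv_exp_fps(2) algebra_simps)
qed (simp add: exp_fps_def conj_fps_def)

text \<open>
  With \<open>d n = D (f ^ n)\<close> and \<open>a = D f\<close>, the recurrence is the Leibniz rule for \<open>f * f ^ n\<close>, and the left
  hand side is \<open>D (exp(X f))\<close>. Both sides solve \<open>Y' = f Y + a exp(X f)\<close>.
\<close>

lemma first_derivative_of_exp_fps:
  fixes f a :: "'a::cstar_algebra"
  assumes 0: "d 0 = 0" and Suc: "\<And>n. d (Suc n) = a * f ^ n + f * d n"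
  shows "Abs_fps (\<lambda>n. d n /\<^sub>R fact n) = exp_fps f * fps_antideriv (conj_fps f a)"
proof (rule fps_linear_ode_unique)
  show "fps_deriv (Abs_fps (\<lambda>n. d n /\<^sub>R fact n))
      = fps_const f * Abs_fps (\<lambda>n. d n /\<^sub>R fact n) + Abs_fps (\<lambda>n. d n /\<^sub>R fact n) * fps_const 0
        + fps_const a * exp_fps f"
    unfolding fps_deriv_scaled_by_fact exp_fps_def
    by (rule fps_ext) (simp add: Suc algebra_simps)
  show "fps_deriv (exp_fps f * fps_antideriv (conj_fps f a))
      = fps_const f * (exp_fps f * fps_antideriv (conj_fps f a))
        + exp_fps f * fps_antideriv (conj_fps f a) * fps_const 0 + fps_const a * exp_fps f"
    by (simp add: fps_deriv_antideriv fps_deriv_exp_fps(1) exp_fps_conj_fps algebra_simps)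
qed (simp add: 0)

text \<open>
  With also \<open>e n = D (D (f ^ n))\<close> and \<open>b = D a\<close>, both sides solve the equation obtained by applying
  \<open>D\<close> twice to \<open>Y' = f Y\<close>, namely \<open>Y' = f Y + b exp(X f) + 2 a D (exp(X f))\<close>.
\<close>

lemma second_derivative_of_exp_fps:
  fixes f a b :: "'a::cstar_algebra"
  assumes d0: "d 0 = 0" and dSuc: "\<And>n. d (Suc n) = a * f ^ n + f * d n"
    and 0: "e 0 = 0" and Suc: "\<And>n. e (Suc n) = b * f ^ n + 2 * (a * d n) + f * e n"
  shows "Abs_fps (\<lambda>n. e n /\<^sub>R fact n) = exp_fps f * fps_antideriv
    (conj_fps f b + 2 * (conj_fps f a * fps_antideriv (conj_fps f a)))"
    (is "?E = exp_fps f * fps_antideriv ?Y")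
proof (rule fps_linear_ode_unique)
  let ?Z = "fps_const b * exp_fps f
    + 2 * (fps_const a * (exp_fps f * fps_antideriv (conj_fps f a)))"
  show "fps_deriv ?E = fps_const f * ?E + ?E * fps_const 0 + ?Z"
    unfolding fps_deriv_scaled_by_fact first_derivative_of_exp_fps[OF d0 dSuc, symmetric]
    unfolding exp_fps_def
    by (rule fps_ext) (simp add: Suc algebra_simps numeral_fps_const)
  have two: "exp_fps f * (2 * Q) = 2 * (exp_fps f * Q)" for Q
    by (simp add: mult_2 algebra_simps)
  have conj: "exp_fps f * (conj_fps f x * Q) = fps_const x * (exp_fps f * Q)" for x Q
    by (simp add: mult.assoc[symmetric] exp_fps_conj_fps)
  show "fps_deriv (exp_fps f * fps_antideriv ?Y)
      = fps_const f * (exp_fps f * fps_antideriv ?Y)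
        + exp_fps f * fps_antideriv ?Y * fps_const 0 + ?Z"
    by (simp add: fps_deriv_antideriv fps_deriv_exp_fps(1) distrib_left two conj
        exp_fps_conj_fps mult.assoc)
qed (simp add: 0)

section \<open>Absolutely summable double series\<close>

lemma
  fixes u :: "'i \<Rightarrow> 'a::{real_normed_algebra,banach}"
  assumes u: "(\<lambda>i. norm (u i)) summable_on I" and v: "(\<lambda>j. norm (v j)) summable_on J"
  shows abs_summable_on_mult: "(\<lambda>(i, j). norm (u i * v j)) summable_on I \<times> J"
    and has_sum_mult: "((\<lambda>(i, j). u i * v j) has_sum infsum u I * infsum v J) (I \<times> J)"
proof -
  have "(\<lambda>p. norm (u (fst p)) * norm (v (snd p))) summable_on I \<times> J"
    by (rule summable_on_SigmaI[where g = "\<lambda>i. norm (u i) * infsum (\<lambda>j. norm (v j)) J"])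
       (auto intro!: has_sum_cmult_right has_sum_infsum summable_on_cmult_left u v)
  then show *: "(\<lambda>(i, j). norm (u i * v j)) summable_on I \<times> J"
    by (rule summable_on_comparison_test) (auto simp: norm_mult_ineq)
  show "((\<lambda>(i, j). u i * v j) has_sum infsum u I * infsum v J) (I \<times> J)"
  proof (rule has_sum_SigmaI)
    show "((\<lambda>j. case (i, j) of (i, j) \<Rightarrow> u i * v j) has_sum u i * infsum v J) J" for i
      using has_sum_bounded_linear[OF bounded_linear_mult_right
          has_sum_infsum[OF abs_summable_summable[OF v]]] by simp
    show "((\<lambda>i. u i * infsum v J) has_sum infsum u I * infsum v J) I"
      by (rule has_sum_bounded_linear[OF bounded_linear_mult_left
          has_sum_infsum[OF abs_summable_summable[OF u]]])
  qed (rule abs_summable_summable, use * in \<open>simp add: case_prod_unfold\<close>)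
qed

text \<open>
  Summation by total degree; it turns double power series into single ones.
\<close>

lemma has_sum_antidiagonal:
  fixes g :: "nat \<times> nat \<Rightarrow> 'a::banach"
  assumes "(g has_sum S) UNIV"
  shows "((\<lambda>n. \<Sum>i\<le>n. g (i, n - i)) has_sum S) UNIV"
proof (rule has_sum_SigmaD)
  have "((\<lambda>(n, i). g (i, n - i)) has_sum S) (Sigma UNIV (\<lambda>n. {..n})) \<longleftrightarrow> (g has_sum S) UNIV"
    by (rule has_sum_reindex_bij_witness[where i = "\<lambda>(i, k). (i + k, i)" and j = "\<lambda>(n, i). (i, n - i)"])
       auto
  then show "((\<lambda>(n, i). g (i, n - i)) has_sum S) (Sigma UNIV (\<lambda>n. {..n}))"
    using assms by simp
qed (auto intro: has_sum_finite)

section \<open>Taylor coefficients of K and H\<close>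

text \<open>
  The series is not assumed to converge to 0 at \<open>x = 0\<close>, since \<open>K_fun\<close> and \<open>H_fun\<close> have junk values on
  the zero set of their denominators. The lowest coefficient is recovered as a limit at 0.
\<close>

lemma power_series_coeffs_zero:
  fixes a :: "nat \<Rightarrow> complex"
  assumes "0 < r" and sums: "\<And>x. 0 < norm x \<Longrightarrow> norm x < r \<Longrightarrow> (\<lambda>n. a n * x ^ n) sums 0"
  shows "a n = 0"
proof (induction n rule: less_induct)
  case (less n)
  have "(\<lambda>m. a (m + n) * x ^ m) sums 0" if "x \<noteq> 0" "norm x < r" for x
  proof -
    have "(\<lambda>m. a (m + n) * x ^ (m + n)) sums (0 - (\<Sum>i<n. a i * x ^ i))"
      using sums[of x] that by (subst sums_iff_shift) simp
    also have "(\<Sum>i<n. a i * x ^ i) = 0"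
      using less by simp
    finally have "(\<lambda>m. (a (m + n) * x ^ (m + n)) / x ^ n) sums (0 / x ^ n)"
      by (intro sums_divide) simp
    then show ?thesis
      using that by (simp add: power_add)
  qed
  then have "((\<lambda>_. 0) \<longlongrightarrow> a (0 + n)) (at (0 :: complex))"
    by (intro powser_limit_0_strong[where s = r and a = "\<lambda>m. a (m + n)"]) (use \<open>0 < r\<close> in auto)
  then show ?case
    by (simp add: tendsto_const_iff)
qed

lemma K_fun_sums:
  assumes "s \<noteq> 0"
  shows "(\<lambda>n. s ^ n / fact (Suc n)) sums K_fun s"
proof -
  have "(\<lambda>n. s ^ Suc n / fact (Suc n)) sums (exp s - 1)"
    using exp_converges[of s] by (subst sums_Suc_iff) (simp add: scaleR_conv_of_real field_simps)
  then have "(\<lambda>n. s ^ Suc n / fact (Suc n) / s) sums ((exp s - 1) / s)"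
    by (rule sums_divide)
  then show ?thesis
    using assms by (simp add: K_fun_def del: fact_Suc)
qed

lemma K_coeff_eq: "K_coeff n = complex_of_real (inverse (fact (Suc n)))"
proof -
  have "K_coeff = (\<lambda>n. complex_of_real (inverse (fact (Suc n))))"
    unfolding K_coeff_def
  proof (rule the_equality)
    show *: "\<forall>s. s \<noteq> 0 \<longrightarrow> (\<lambda>n. complex_of_real (inverse (fact (Suc n))) * s ^ n) sums K_fun s"
      using K_fun_sums by (simp add: field_simps del: fact_Suc)
    fix c assume c: "\<forall>s. s \<noteq> 0 \<longrightarrow> (\<lambda>n. c n * s ^ n) sums K_fun s"
    have "c n - complex_of_real (inverse (fact (Suc n))) = 0" for n
    proof (rule power_series_coeffs_zero[of 1 "\<lambda>n. c n - complex_of_real (inverse (fact (Suc n)))"])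
      fix x :: complex assume "0 < norm x"
      then show "(\<lambda>n. (c n - complex_of_real (inverse (fact (Suc n)))) * x ^ n) sums 0"
        using sums_diff[OF c[rule_format, of x] *[rule_format, of x]]
        by (simp add: algebra_simps del: fact_Suc)
    qed simp
    then show "c = (\<lambda>n. complex_of_real (inverse (fact (Suc n))))"
      by auto
  qed
  then show ?thesis by (rule fun_cong)
qed

text \<open>
  For fixed \<open>t \<noteq> 0\<close>, the hypothesis covers all \<open>s\<close> with \<open>0 < |s| < |t|\<close>, so the uniqueness theorem in one
  variable can be applied first in \<open>s\<close> and then in \<open>t\<close>.
\<close>

lemma double_power_series_coeffs_zero:
  fixes c :: "nat \<Rightarrow> nat \<Rightarrow> complex"
  assumes "\<And>s t. s \<noteq> 0 \<Longrightarrow> t \<noteq> 0 \<Longrightarrow> s + t \<noteq> 0 \<Longrightarrow>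
    ((\<lambda>(m, n). c m n * s ^ m * t ^ n) has_sum 0) UNIV"
  shows "c m n = 0"
proof -
  have inner: "((\<lambda>n. c m n * t ^ n) has_sum 0) UNIV" if "t \<noteq> 0" for t m
  proof -
    define C where "C m = (\<Sum>\<^sub>\<infinity>n. c m n * t ^ n)" for m
    have C: "((\<lambda>n. c m n * s ^ m * t ^ n) has_sum C m * s ^ m) UNIV
        \<and> (\<lambda>m. C m * s ^ m) sums 0"
      if s: "s \<noteq> 0" "norm s < norm t" for s m
    proof -
      have "s + t \<noteq> 0"
        using s by (metis add_eq_0_iff norm_minus_cancel less_irrefl)
      then have sum: "((\<lambda>(m, n). c m n * s ^ m * t ^ n) has_sum 0) (UNIV \<times> UNIV)"
        using assms s \<open>t \<noteq> 0\<close> by simp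
      have *: "((\<lambda>n. c m n * s ^ m * t ^ n) has_sum C m * s ^ m) UNIV" for m
      proof -
        have "(\<lambda>n. c m n * s ^ m * t ^ n) summable_on UNIV"
          by (rule summable_on_SigmaD1[OF has_sum_imp_summable[OF sum]]) simp
        then have "(\<lambda>n. s ^ m * (c m n * t ^ n)) summable_on UNIV"
          by (simp add: mult_ac)
        then have "(\<lambda>n. c m n * t ^ n) summable_on UNIV"
          using s by (subst (asm) summable_on_cmult_right') auto
        then have "((\<lambda>n. s ^ m * (c m n * t ^ n)) has_sum s ^ m * C m) UNIV"
          unfolding C_def by (intro has_sum_cmult_right has_sum_infsum)
        then show ?thesis
          by (simp add: mult_ac)
      qed
      have "((\<lambda>m. C m * s ^ m) has_sum 0) UNIV"
        by (rule has_sum_SigmaD[OF sum]) (use * in simp)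
      then show ?thesis
        using * has_sum_imp_sums by blast
    qed
    \<comment> \<open>The uniqueness theorem in \<open>s\<close>, on the punctured disc \<open>0 < |s| < |t|\<close> where \<open>s + t \<noteq> 0\<close>.\<close>
    have "C m = 0"
      by (rule power_series_coeffs_zero[of "norm t"]) (use C that in auto)
    moreover obtain s :: complex where "s \<noteq> 0" "norm s < norm t"
      using \<open>t \<noteq> 0\<close> by (intro that[of "t / 2"]) (auto simp: norm_divide)
    ultimately have "((\<lambda>n. c m n * s ^ m * t ^ n / s ^ m) has_sum 0 / s ^ m) UNIV"
      using C[of s m] by (intro has_sum_divide_const) simp
    then show ?thesis
      using \<open>s \<noteq> 0\<close> by simp
  qed
  show ?thesis
    by (rule power_series_coeffs_zero[of 1]) (auto intro!: has_sum_imp_sums inner)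
qed

lemma abs_summable_exp_series: "(\<lambda>n. norm (x ^ n / fact n)) summable_on (UNIV :: nat set)"
  for x :: complex
  using summable_norm_exp[of x]
  by (intro summable_nonneg_imp_summable_on) (auto simp: scaleR_conv_of_real divide_inverse mult.commute)

lemma abs_summable_K_series: "(\<lambda>n. norm (x ^ n / fact (Suc n))) summable_on (UNIV :: nat set)"
  for x :: complex
  by (rule Infinite_Sum.abs_summable_on_comparison_test[OF abs_summable_exp_series[of x]])
     (auto simp: norm_divide norm_mult norm_power intro!: divide_left_mono mult_left_mono
       simp del: of_nat_Suc)

lemma infsum_K_series: "s \<noteq> 0 \<Longrightarrow> (\<Sum>\<^sub>\<infinity>n. s ^ n / fact (Suc n)) = K_fun s"
  using K_fun_sums[of s] abs_summable_summable[OF abs_summable_K_series[of s]]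
  by (metis has_sum_imp_sums has_sum_infsum sums_unique2)

text \<open>
  By the binomial theorem the terms of total degree \<open>n\<close> add up to \<open>(s + t) ^ n / (n + 1)!\<close>.
\<close>

lemma K_fun_add_has_sum:
  assumes "s + t \<noteq> 0"
  shows "((\<lambda>(m, k). s ^ m * t ^ k / (fact m * fact k * of_nat (Suc (m + k)))) has_sum K_fun (s + t)) UNIV"
    (is "(?g has_sum _) _")
proof -
  have "(\<lambda>(m, k). norm (s ^ m / fact m * (t ^ k / fact k))) summable_on UNIV \<times> UNIV"
    by (rule abs_summable_on_mult) (rule abs_summable_exp_series)+
  then have "(\<lambda>p. norm (?g p)) summable_on UNIV"
    unfolding UNIV_Times_UNIV
  proof (rule summable_on_comparison_test)
    have "norm (x / of_nat (Suc n)) \<le> norm x" for x :: complex and n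
      unfolding norm_divide norm_of_nat using divide_left_mono[of 1 "real (Suc n)" "norm x"] by simp
    note le = this
    show "norm (?g p) \<le> (case p of (m, k) \<Rightarrow> norm (s ^ m / fact m * (t ^ k / fact k)))" for p
      using le[of "s ^ fst p / fact (fst p) * (t ^ snd p / fact (snd p))" "fst p + snd p"]
      by (cases p) (simp add: mult.assoc)
  qed simp
  then obtain S where S: "(?g has_sum S) UNIV"
    using abs_summable_summable has_sum_infsum by blast
  have "(\<Sum>i\<le>n. ?g (i, n - i)) = (s + t) ^ n / fact (Suc n)" for n
  proof -
    have "(\<Sum>i\<le>n. ?g (i, n - i))
        = (\<Sum>i\<le>n. (s ^ i /\<^sub>R fact i) * (t ^ (n - i) /\<^sub>R fact (n - i))) / of_nat (Suc n)"
      unfolding sum_divide_distrib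
      by (intro sum.cong refl) (simp add: scaleR_conv_of_real divide_inverse mult_ac del: of_nat_Suc)
    also have "\<dots> = ((s + t) ^ n /\<^sub>R fact n) / of_nat (Suc n)"
      by (subst exp_series_add_commuting) (auto simp: mult.commute)
    finally show ?thesis
      by (simp add: scaleR_conv_of_real divide_inverse mult_ac)
  qed
  then have "(\<lambda>n. (s + t) ^ n / fact (Suc n)) sums S"
    using has_sum_imp_sums[OF has_sum_antidiagonal[OF S]] by simp
  then have "S = K_fun (s + t)"
    using K_fun_sums[OF assms] sums_unique2 by blast
  then show ?thesis
    using S by simp
qed

text \<open>
  The Taylor series of \<open>L\<close>, the integral of \<open>e^(q s + p t)\<close> over the simplex \<open>0 \<le> p \<le> q \<le> 1\<close>:
  delete from the series of \<open>K(s + t)\<close> the terms without \<open>t\<close>, which form the series of \<open>K(s)\<close>, and divide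
  by \<open>t\<close>.
\<close>

lemma simplex_integral_has_sum:
  assumes "s \<noteq> 0" "t \<noteq> 0" "s + t \<noteq> 0"
  shows "((\<lambda>(m, n). s ^ m * t ^ n / (fact m * fact (Suc n) * of_nat (m + n + 2)))
    has_sum (K_fun (s + t) - K_fun s) / t) UNIV"
proof -
  let ?g = "\<lambda>(m, k). s ^ m * t ^ k / (fact m * fact k * of_nat (Suc (m + k)))"
  have "((\<lambda>m. s ^ m / fact (Suc m)) has_sum K_fun s) UNIV"
    using has_sum_infsum[OF abs_summable_summable[OF abs_summable_K_series[of s]]]
    by (simp only: infsum_K_series[OF \<open>s \<noteq> 0\<close>])
  also have "?this \<longleftrightarrow> (?g has_sum K_fun s) (UNIV \<times> {0})"
    by (rule has_sum_reindex_bij_witness[where i = fst and j = "\<lambda>m. (m, 0)"]) (auto simp: mult_ac)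
  finally have "(?g has_sum K_fun (s + t) - K_fun s) (UNIV - UNIV \<times> {0})"
    by (intro has_sum_Diff K_fun_add_has_sum[OF \<open>s + t \<noteq> 0\<close>]) auto
  also have "?this \<longleftrightarrow> ((\<lambda>(m, n). ?g (m, Suc n)) has_sum K_fun (s + t) - K_fun s) UNIV"
    by (rule sym, rule has_sum_reindex_bij_witness[where j = "\<lambda>(m, n). (m, Suc n)" and i = "\<lambda>(m, k). (m, k - 1)"])
       auto
  finally have "((\<lambda>p. (case p of (m, n) \<Rightarrow> ?g (m, Suc n)) / t) has_sum (K_fun (s + t) - K_fun s) / t) UNIV"
    by (rule has_sum_divide_const)
  also have "(\<lambda>p. (case p of (m, n) \<Rightarrow> ?g (m, Suc n)) / t)
      = (\<lambda>(m, n). s ^ m * t ^ n / (fact m * fact (Suc n) * of_nat (m + n + 2)))"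
    using \<open>t \<noteq> 0\<close> by (auto simp: fun_eq_iff)
  finally show ?thesis .
qed

text \<open>
  The coefficients of \<open>K(s) K(t) / 2 - 2 L(s,t)\<close>.
\<close>

definition H_taylor :: "nat \<Rightarrow> nat \<Rightarrow> real" where
  "H_taylor m n = 1 / (2 * fact (Suc m) * fact (Suc n)) - 2 / (fact m * fact (Suc n) * real (m + n + 2))"

lemma H_fun_decomposition:
  assumes "s \<noteq> 0" "t \<noteq> 0" "s + t \<noteq> 0"
  shows "H_fun s t = 1 / 2 * (K_fun s * K_fun t) + - 2 * ((K_fun (s + t) - K_fun s) / t)"
  using assms by (simp add: H_fun_def K_fun_def exp_add divide_simps) (simp add: algebra_simps)

lemma H_fun_has_sum:
  assumes "s \<noteq> 0" "t \<noteq> 0" "s + t \<noteq> 0"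
  shows "((\<lambda>(m, n). complex_of_real (H_taylor m n) * s ^ m * t ^ n) has_sum H_fun s t) UNIV"
proof -
  have "((\<lambda>(m, n). s ^ m / fact (Suc m) * (t ^ n / fact (Suc n))) has_sum K_fun s * K_fun t) UNIV"
    using has_sum_mult[OF abs_summable_K_series abs_summable_K_series, of s t] assms
    by (simp add: infsum_K_series del: fact_Suc)
  from has_sum_add[OF has_sum_cmult_right[OF this, of "1 / 2"]
      has_sum_cmult_right[OF simplex_integral_has_sum[OF assms], of "- 2"]]
  have "((\<lambda>p. 1 / 2 * (case p of (m, n) \<Rightarrow> s ^ m / fact (Suc m) * (t ^ n / fact (Suc n)))
      + - 2 * (case p of (m, n) \<Rightarrow> s ^ m * t ^ n / (fact m * fact (Suc n) * of_nat (m + n + 2))))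
    has_sum H_fun s t) UNIV"
    by (simp only: H_fun_decomposition[OF assms])
  also have "(\<lambda>p. 1 / 2 * (case p of (m, n) \<Rightarrow> s ^ m / fact (Suc m) * (t ^ n / fact (Suc n)))
      + - 2 * (case p of (m, n) \<Rightarrow> s ^ m * t ^ n / (fact m * fact (Suc n) * of_nat (m + n + 2))))
    = (\<lambda>(m, n). complex_of_real (H_taylor m n) * s ^ m * t ^ n)"
    by (auto simp: fun_eq_iff H_taylor_def algebra_simps simp del: fact_Suc of_nat_add)
  finally show ?thesis .
qed

lemma H_coeff_eq: "H_coeff m n = complex_of_real (H_taylor m n)"
proof -
  have "H_coeff = (\<lambda>m n. complex_of_real (H_taylor m n))"
    unfolding H_coeff_def
  proof (rule the_equality)
    show "\<forall>s t. s \<noteq> 0 \<and> t \<noteq> 0 \<and> s + t \<noteq> 0 \<longrightarrow>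
        ((\<lambda>(m, n). complex_of_real (H_taylor m n) * s ^ m * t ^ n) has_sum H_fun s t) UNIV"
      using H_fun_has_sum by blast
    fix c assume c: "\<forall>s t. s \<noteq> 0 \<and> t \<noteq> 0 \<and> s + t \<noteq> 0 \<longrightarrow>
        ((\<lambda>(m, n). c m n * s ^ m * t ^ n) has_sum H_fun s t) UNIV"
    have "c m n - complex_of_real (H_taylor m n) = 0" for m n
    proof (rule double_power_series_coeffs_zero[of "\<lambda>m n. c m n - complex_of_real (H_taylor m n)"])
      fix s t :: complex assume *: "s \<noteq> 0" "t \<noteq> 0" "s + t \<noteq> 0"
      have "((\<lambda>(m, n). c m n * s ^ m * t ^ n) has_sum H_fun s t) UNIV"
        using c * by blast
      from has_sum_add[OF this has_sum_uminusI[OF H_fun_has_sum[OF *]]]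
      show "((\<lambda>(m, n). (c m n - complex_of_real (H_taylor m n)) * s ^ m * t ^ n) has_sum 0) UNIV"
        by (simp add: case_prod_unfold algebra_simps)
    qed
    then show "c = (\<lambda>m n. complex_of_real (H_taylor m n))"
      by (auto simp: fun_eq_iff)
  qed
  then show ?thesis
    by (simp add: fun_eq_iff)
qed

section \<open>Evaluation at X = 1\<close>

definition fps_norm_summable :: "'a::real_normed_algebra_1 fps \<Rightarrow> bool" where
  "fps_norm_summable F \<longleftrightarrow> summable (\<lambda>n. norm (fps_nth F n))"

definition fps_at_1 :: "'a::real_normed_algebra_1 fps \<Rightarrow> 'a" where
  "fps_at_1 F = (\<Sum>n. fps_nth F n)"

lemma
  fixes F G :: "'a::{real_normed_algebra_1,banach} fps"
  assumes F: "fps_norm_summable F" and G: "fps_norm_summable G"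
  shows fps_norm_summable_mult: "fps_norm_summable (F * G)"
    and fps_at_1_mult: "fps_at_1 (F * G) = fps_at_1 F * fps_at_1 G"
proof -
  have "summable (\<lambda>n. \<Sum>i\<le>n. norm (fps_nth F i) * norm (fps_nth G (n - i)))"
    using F G by (intro summable_Cauchy_product) (simp_all add: fps_norm_summable_def)
  then show "fps_norm_summable (F * G)"
    unfolding fps_norm_summable_def
    by (rule summable_comparison_test_ev[rotated])
       (auto simp: fps_mult_nth atLeast0AtMost intro!: always_eventually norm_sum[THEN order_trans] sum_mono norm_mult_ineq)
  show "fps_at_1 (F * G) = fps_at_1 F * fps_at_1 G"
    using Cauchy_product[of "fps_nth F" "fps_nth G"] F G
    by (simp add: fps_at_1_def fps_norm_summable_def fps_mult_nth atLeast0AtMost)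
qed

lemma
  fixes F G :: "'a::{real_normed_algebra_1,banach} fps"
  assumes F: "fps_norm_summable F" and G: "fps_norm_summable G"
  shows fps_norm_summable_add: "fps_norm_summable (F + G)"
    and fps_at_1_add: "fps_at_1 (F + G) = fps_at_1 F + fps_at_1 G"
proof -
  have "summable (\<lambda>n. norm (fps_nth F n) + norm (fps_nth G n))"
    using F G by (intro summable_add) (simp_all add: fps_norm_summable_def)
  then show "fps_norm_summable (F + G)"
    unfolding fps_norm_summable_def
    by (rule summable_comparison_test_ev[rotated])
       (auto intro!: always_eventually norm_triangle_ineq)
  show "fps_at_1 (F + G) = fps_at_1 F + fps_at_1 G"
    using F G by (simp add: fps_at_1_def fps_norm_summable_def suminf_add summable_norm_cancel)
qed

lemma fps_norm_summable_antideriv: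
  fixes F :: "'a::{real_normed_algebra_1,banach} fps"
  assumes F: "fps_norm_summable F"
  shows "fps_norm_summable (fps_antideriv F)"
proof -
  have "summable (\<lambda>n. norm (fps_nth (fps_antideriv F) (Suc n)))"
    using F unfolding fps_norm_summable_def
  proof (rule summable_comparison_test_ev[rotated], intro always_eventually allI)
    fix n show "norm (norm (fps_nth (fps_antideriv F) (Suc n))) \<le> norm (fps_nth F n)"
      using divide_left_mono[of 1 "real (Suc n)" "norm (fps_nth F n)"]
      by (simp add: fps_antideriv_def divide_inverse mult.commute)
  qed
  then show ?thesis
    unfolding fps_norm_summable_def by (subst (asm) summable_Suc_iff)
qed

lemma fps_antideriv_add:
  "fps_antideriv (F + G) = fps_antideriv F + (fps_antideriv G :: 'a::real_algebra_1 fps)"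
  by (rule fps_ext) (simp add: fps_antideriv_def scaleR_add_right)

lemma fps_at_1_exp_fps: "fps_at_1 (exp_fps f) = exp f" for f :: "'a::{real_normed_algebra_1,banach}"
  by (simp add: fps_at_1_def exp_fps_def exp_def)

lemma fps_norm_summable_exp_fps: "fps_norm_summable (exp_fps f)"
  for f :: "'a::{real_normed_algebra_1,banach}"
  using summable_norm_exp[of f] by (simp add: fps_norm_summable_def exp_fps_def)

lemma norm_nabla_power_le: "norm ((nabla f ^^ n) x) \<le> (2 * norm f) ^ n * norm x"
proof (induction n)
  case (Suc n)
  have "norm (nabla f y) \<le> 2 * norm f * norm y" for y
    unfolding nabla_def norm_minus_cancel
    using norm_triangle_ineq4[of "f * y" "y * f"] norm_mult_ineq[of f y] norm_mult_ineq[of y f]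
    by (simp add: mult_ac)
  from this[of "(nabla f ^^ n) x"] mult_left_mono[OF Suc, of "2 * norm f"]
  show ?case
    by (simp add: mult_ac)
qed simp

lemma fps_norm_summable_conj_fps: "fps_norm_summable (conj_fps f x)"
proof -
  have "summable (\<lambda>n. norm x * norm ((2 * norm f) ^ n /\<^sub>R fact n))"
    by (intro summable_mult summable_norm_exp)
  then show ?thesis
    unfolding fps_norm_summable_def
    by (rule summable_comparison_test_ev[rotated])
       (use norm_nabla_power_le[of _ f x] in \<open>auto intro!: always_eventually simp: conj_fps_def field_simps\<close>)
qed

lemma K_nabla_sums: "(\<lambda>n. (nabla f ^^ n) x /\<^sub>R fact (Suc n)) sums fps_at_1 (fps_antideriv (conj_fps f x))"
proof -
  have "fps_nth (fps_antideriv (conj_fps f x)) sums fps_at_1 (fps_antideriv (conj_fps f x))"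
    using fps_norm_summable_antideriv[OF fps_norm_summable_conj_fps]
    unfolding fps_norm_summable_def fps_at_1_def
    by (rule summable_sums[OF summable_norm_cancel])
  then have "(\<lambda>n. fps_nth (fps_antideriv (conj_fps f x)) (Suc n)) sums fps_at_1 (fps_antideriv (conj_fps f x))"
    by (subst sums_Suc_iff) simp
  then show ?thesis
    by (simp add: fps_antideriv_def conj_fps_def)
qed

lemma scaleC_of_real: "complex_of_real r *\<^sub>C x = r *\<^sub>R x"
  by (rule scaleR_scaleC[symmetric])

lemma K_nabla_eq: "K_nabla f x = fps_at_1 (fps_antideriv (conj_fps f x))"
  unfolding K_nabla_def K_coeff_eq scaleC_of_real using K_nabla_sums by (metis sums_unique)

lemma nabla_power_add: "(nabla f ^^ n) (x + y) = (nabla f ^^ n) x + (nabla f ^^ n) y"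
  by (induction n) (simp_all add: nabla_def algebra_simps)

lemma K_nabla_add: "K_nabla f (x + y) = K_nabla f x + K_nabla f y"
proof -
  have "conj_fps f (x + y) = conj_fps f x + conj_fps f y"
    by (rule fps_ext) (simp add: conj_fps_def nabla_power_add scaleR_add_right)
  then show ?thesis
    by (simp add: K_nabla_eq fps_antideriv_add fps_at_1_add fps_norm_summable_antideriv
        fps_norm_summable_conj_fps)
qed

lemma K_nabla_sum: "K_nabla f (sum g I) = (\<Sum>i\<in>I. K_nabla f (g i))"
proof -
  have 0: "K_nabla f 0 = 0"
    using K_nabla_add[of f 0 0] by simp
  show ?thesis
    by (induction I rule: infinite_finite_induct) (simp_all add: 0 K_nabla_add)
qed

text \<open>
  Two antiderivatives of \<open>exp(X \<nabla>) a\<close>, multiplied in the order dictated by the iteration, give the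
  double series of \<open>simplex_integral_has_sum\<close> with \<open>s\<close> acting on the first and \<open>t\<close> on the second factor:
  the inner antiderivative contributes \<open>1 / (n + 1)\<close> and the outer one \<open>1 / (m + n + 2)\<close>. So the value is
  \<open>L(\<nabla>,\<nabla>)(a a)\<close>.
\<close>

lemma iterated_antideriv_has_sum:
  "((\<lambda>(m, n). ((nabla f ^^ m) a * (nabla f ^^ n) a) /\<^sub>R (fact m * fact (Suc n) * real (m + n + 2)))
    has_sum fps_at_1 (fps_antideriv (conj_fps f a * fps_antideriv (conj_fps f a)))) UNIV"
proof -
  define Y where "Y = fps_nth (conj_fps f a)"
  define A where "A = fps_nth (fps_antideriv (conj_fps f a))"
  define Z where "Z = fps_antideriv (conj_fps f a * fps_antideriv (conj_fps f a))"
  let ?g = "\<lambda>(i, k). (Y i * A k) /\<^sub>R real (Suc (i + k))"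
  have Y: "(\<lambda>i. norm (Y i)) summable_on UNIV" and A: "(\<lambda>k. norm (A k)) summable_on UNIV"
    using fps_norm_summable_conj_fps[of f a] fps_norm_summable_antideriv[OF fps_norm_summable_conj_fps, of f a]
    by (auto simp: Y_def A_def fps_norm_summable_def intro!: summable_nonneg_imp_summable_on)
  have "(\<lambda>p. norm (?g p)) summable_on UNIV"
    using abs_summable_on_mult[OF Y A] unfolding UNIV_Times_UNIV
  proof (rule summable_on_comparison_test)
    show "norm (?g p) \<le> (case p of (i, k) \<Rightarrow> norm (Y i * A k))" for p
      using divide_left_mono[of 1 "real (Suc (fst p + snd p))" "norm (Y (fst p) * A (snd p))"]
      by (cases p) (simp add: divide_inverse mult.commute)
  qed simp
  then obtain S where S: "(?g has_sum S) UNIV"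
    using abs_summable_summable has_sum_infsum by blast
  have "(\<Sum>i\<le>n. ?g (i, n - i)) = fps_nth Z (Suc n)" for n
    by (simp add: Z_def fps_antideriv_def[of "_ * _"] fps_mult_nth atLeast0AtMost Y_def A_def scaleR_sum_right)
  then have "(\<lambda>n. fps_nth Z (Suc n)) sums S"
    using has_sum_imp_sums[OF has_sum_antidiagonal[OF S]] by simp
  then have "fps_nth Z sums S"
    by (subst (asm) sums_Suc_iff) (simp add: Z_def)
  then have "S = fps_at_1 Z"
    by (simp add: fps_at_1_def sums_iff)
  with S have *: "(?g has_sum fps_at_1 Z) UNIV"
    by simp
  \<comment> \<open>The constant term of the inner antiderivative is 0, so its index starts at 1.\<close>
  have "((\<lambda>(m, n). ?g (m, Suc n)) has_sum fps_at_1 Z) UNIV \<longleftrightarrow> (?g has_sum fps_at_1 Z) (UNIV \<times> {1..})"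
    by (rule has_sum_reindex_bij_witness[where j = "\<lambda>(m, n). (m, Suc n)" and i = "\<lambda>(m, k). (m, k - 1)"]) auto
  also have "\<dots> \<longleftrightarrow> (?g has_sum fps_at_1 Z) UNIV"
    by (rule has_sum_cong_neutral) (auto simp: A_def Suc_le_eq intro!: gr0I)
  finally have "((\<lambda>(m, n). ?g (m, Suc n)) has_sum fps_at_1 Z) UNIV"
    using * by simp
  also have "(\<lambda>(m, n). ?g (m, Suc n))
      = (\<lambda>(m, n). ((nabla f ^^ m) a * (nabla f ^^ n) a) /\<^sub>R (fact m * fact (Suc n) * real (m + n + 2)))"
    by (auto simp: fun_eq_iff Y_def A_def conj_fps_def fps_antideriv_def field_simps)
  finally show ?thesis
    by (simp add: Z_def)
qed

lemma H_nabla_eq: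
  "H_nabla f a a = (1/2) *\<^sub>R (K_nabla f a * K_nabla f a)
    - 2 *\<^sub>R fps_at_1 (fps_antideriv (conj_fps f a * fps_antideriv (conj_fps f a)))"
    (is "_ = _ - 2 *\<^sub>R ?Q")
proof -
  define k where "k n = (nabla f ^^ n) a /\<^sub>R fact (Suc n)" for n
  have "k = (\<lambda>n. fps_nth (fps_antideriv (conj_fps f a)) (Suc n))"
    by (simp add: k_def fun_eq_iff fps_antideriv_def conj_fps_def)
  then have "summable (\<lambda>n. norm (k n))"
    using fps_norm_summable_antideriv[OF fps_norm_summable_conj_fps, of f a]
    by (simp add: fps_norm_summable_def
        summable_Suc_iff[of "\<lambda>n. norm (fps_nth (fps_antideriv (conj_fps f a)) n)"])
  then have k: "(\<lambda>n. norm (k n)) summable_on UNIV" and "(k has_sum K_nabla f a) UNIV"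
    using K_nabla_sums[of f a]
    by (auto simp: K_nabla_eq k_def[abs_def] intro!: summable_nonneg_imp_summable_on norm_summable_imp_has_sum)
  then have "((\<lambda>(m, n). k m * k n) has_sum K_nabla f a * K_nabla f a) UNIV"
    using has_sum_mult[OF k k] by (simp add: infsumI)
  from has_sum_add[OF has_sum_bounded_linear[OF bounded_linear_scaleR_right this, of "1 / 2"]
      has_sum_bounded_linear[OF bounded_linear_scaleR_right iterated_antideriv_has_sum[of f a], of "- 2"]]
  have "((\<lambda>p. (1/2) *\<^sub>R (case p of (m, n) \<Rightarrow> k m * k n)
      + (- 2) *\<^sub>R (case p of (m, n) \<Rightarrow> ((nabla f ^^ m) a * (nabla f ^^ n) a) /\<^sub>R (fact m * fact (Suc n) * real (m + n + 2))))
    has_sum (1/2) *\<^sub>R (K_nabla f a * K_nabla f a) + (- 2) *\<^sub>R ?Q) UNIV" .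
  also have "(\<lambda>p. (1/2) *\<^sub>R (case p of (m, n) \<Rightarrow> k m * k n)
      + (- 2) *\<^sub>R (case p of (m, n) \<Rightarrow> ((nabla f ^^ m) a * (nabla f ^^ n) a) /\<^sub>R (fact m * fact (Suc n) * real (m + n + 2))))
    = (\<lambda>(m, n). H_coeff m n *\<^sub>C ((nabla f ^^ m) a * (nabla f ^^ n) a))"
  proof (rule ext, clarify)
    fix m n :: nat
    define x where "x = (nabla f ^^ m) a * (nabla f ^^ n) a"
    have k: "k m * k n = (1 / (fact (Suc m) * fact (Suc n))) *\<^sub>R x"
      unfolding k_def x_def mult_scaleR_left mult_scaleR_right scaleR_scaleR inverse_eq_divide
      by (simp only: times_divide_times_eq mult_1 mult.commute)
    have c: "1 / 2 * (1 / (fact (Suc m) * fact (Suc n)))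
        + - 2 * inverse (fact m * fact (Suc n) * real (m + n + 2)) = H_taylor m n"
      unfolding H_taylor_def divide_inverse by (simp only: inverse_mult_distrib mult_1 mult_minus_left mult.assoc
        add_uminus_conv_diff)
    have "(1/2) *\<^sub>R (k m * k n) + (- 2) *\<^sub>R (x /\<^sub>R (fact m * fact (Suc n) * real (m + n + 2)))
        = H_coeff m n *\<^sub>C x"
      unfolding k H_coeff_eq scaleC_of_real scaleR_scaleR scaleR_left_distrib[symmetric] c ..
    then show "(1/2) *\<^sub>R (k m * k n)
        + (- 2) *\<^sub>R (((nabla f ^^ m) a * (nabla f ^^ n) a) /\<^sub>R (fact m * fact (Suc n) * real (m + n + 2)))
        = H_coeff m n *\<^sub>C ((nabla f ^^ m) a * (nabla f ^^ n) a)"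
      unfolding x_def .
  qed
  finally show ?thesis
    by (simp add: H_nabla_def infsumI)
qed

text \<open>
  Duhamel's formulas of order one and two, for the series that result from differentiating the
  exponential series term by term.
\<close>

lemma derivatives_of_exp_sums:
  fixes f a b :: "'a::cstar_algebra"
  assumes d: "d 0 = 0" "\<And>n. d (Suc n) = a * f ^ n + f * d n"
    and e: "e 0 = 0" "\<And>n. e (Suc n) = b * f ^ n + 2 * (a * d n) + f * e n"
  shows "(\<lambda>n. d n /\<^sub>R fact n) sums (exp f * K_nabla f a)"
    and "(\<lambda>n. e n /\<^sub>R fact n) sums (exp f * (K_nabla f b
      + 2 *\<^sub>R fps_at_1 (fps_antideriv (conj_fps f a * fps_antideriv (conj_fps f a)))))"
proof -
  let ?Q = "conj_fps f a * fps_antideriv (conj_fps f a)"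
  note S = fps_norm_summable_conj_fps fps_norm_summable_exp_fps fps_norm_summable_antideriv
    fps_norm_summable_mult fps_norm_summable_add
  have sums: "fps_nth F sums fps_at_1 F" if "fps_norm_summable F" for F :: "'a fps"
    using that unfolding fps_norm_summable_def fps_at_1_def by (rule summable_sums[OF summable_norm_cancel])
  have "fps_at_1 (exp_fps f * fps_antideriv (conj_fps f a)) = exp f * K_nabla f a"
    by (simp add: fps_at_1_mult S K_nabla_eq fps_at_1_exp_fps)
  moreover have "fps_nth (exp_fps f * fps_antideriv (conj_fps f a)) = (\<lambda>n. d n /\<^sub>R fact n)"
    unfolding first_derivative_of_exp_fps[OF d, symmetric] by (simp add: fun_eq_iff)
  ultimately show "(\<lambda>n. d n /\<^sub>R fact n) sums (exp f * K_nabla f a)"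
    using sums[of "exp_fps f * fps_antideriv (conj_fps f a)"] by (simp add: S)
  have "fps_at_1 (exp_fps f * fps_antideriv (conj_fps f b + (?Q + ?Q)))
      = exp f * (K_nabla f b + 2 *\<^sub>R fps_at_1 (fps_antideriv ?Q))"
    by (simp add: fps_at_1_mult fps_at_1_add S K_nabla_eq fps_at_1_exp_fps fps_antideriv_add scaleR_2)
  moreover have "fps_nth (exp_fps f * fps_antideriv (conj_fps f b + (?Q + ?Q))) = (\<lambda>n. e n /\<^sub>R fact n)"
    unfolding mult_2[symmetric] second_derivative_of_exp_fps[OF d e, symmetric] by (simp add: fun_eq_iff)
  ultimately show "(\<lambda>n. e n /\<^sub>R fact n) sums (exp f * (K_nabla f b + 2 *\<^sub>R fps_at_1 (fps_antideriv ?Q)))"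
    using sums[of "exp_fps f * fps_antideriv (conj_fps f b + (?Q + ?Q))"] by (simp add: S)
qed

section \<open>Monomials in the generators\<close>

lemma scaleC_one [simp]: "1 *\<^sub>C x = (x :: 'a::cstar_algebra)"
  using scaleR_scaleC[of 1 x] by simp

lemma bounded_linear_scaleC_right: "bounded_linear (\<lambda>x :: 'a::cstar_algebra. c *\<^sub>C x)"
  by (rule bounded_linear_intro[where K = "cmod c"])
     (simp_all add: scaleC_add_right scaleR_scaleC scaleC_scaleC norm_scaleC mult.commute)

lemma bounded_linear_scaleC_left: "bounded_linear (\<lambda>c. c *\<^sub>C (x :: 'a::cstar_algebra))"
  by (rule bounded_linear_intro[where K = "norm x"])
     (simp_all add: scaleC_add_left scaleR_scaleC scaleC_scaleC norm_scaleC scaleR_conv_of_real)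

lemma scaleC_zero [simp]: "0 *\<^sub>C x = (0 :: 'a::cstar_algebra)" "c *\<^sub>C 0 = (0 :: 'a)"
  using linear_0[OF bounded_linear.linear[OF bounded_linear_scaleC_left[of x]]]
    linear_0[OF bounded_linear.linear[OF bounded_linear_scaleC_right[where 'a = 'a, of c]]] by auto

definition unitary :: "'a::cstar_algebra \<Rightarrow> bool" where
  "unitary u \<longleftrightarrow> star u * u = 1 \<and> u * star u = 1"

lemma norm_unitary: "unitary u \<Longrightarrow> norm u = 1"
  using cstar_identity[of u] power2_eq_imp_eq[of "norm u" 1] by (simp add: unitary_def)

lemma unitary_star: "unitary u \<Longrightarrow> unitary (star u)"
  by (simp add: unitary_def star_star)

lemma norm_upow_le:
  assumes "unitary u"
  shows "norm (upow u n) \<le> 1"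
  using norm_power_ineq[of u] norm_power_ineq[of "star u"] norm_unitary[OF assms]
    norm_unitary[OF unitary_star[OF assms]]
  by (simp add: upow_def)

lemma upow_0 [simp]: "upow u 0 = 1"
  by (simp add: upow_def)

lemma upow_succ:
  assumes "unitary u"
  shows "upow u (n + 1) = upow u n * u"
proof (cases "0 \<le> n")
  case True
  then show ?thesis
    by (simp add: upow_def nat_add_distrib power_commutes)
next
  case False
  define m where "m = nat (- n - 1)"
  have n: "n = - int (Suc m)"
    using False by (simp add: m_def)
  have "upow u n * u = star u ^ m * (star u * u)"
    by (simp add: upow_def n power_Suc2 mult.assoc del: of_nat_Suc power_Suc)
  also have "\<dots> = upow u (n + 1)"
    using assms by (simp add: unitary_def upow_def n)
  finally show ?thesis by simp
qed

lemma upow_pred: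
  assumes "unitary u"
  shows "upow u (n - 1) = upow u n * star u"
proof -
  have "upow u n * star u = upow u (n - 1) * (u * star u)"
    using upow_succ[OF assms, of "n - 1"] by (simp add: mult.assoc)
  then show ?thesis
    using assms by (simp add: unitary_def)
qed

lemma upow_add:
  assumes "unitary u"
  shows "upow u (m + n) = upow u m * upow u n"
proof (induction n rule: int_induct[where k = 0])
  case (step1 i)
  then show ?case
    using upow_succ[OF assms, of "m + i"] upow_succ[OF assms, of i] by (simp add: algebra_simps)
next
  case (step2 i)
  then show ?case
    using upow_pred[OF assms, of "m + i"] upow_pred[OF assms, of i] by (simp add: algebra_simps)
qed simp

text \<open>
  Equality up to a scalar of modulus 1. All estimates below are by absolute values, so the actual
  phases, which depend on \<open>\<Theta>\<close>, never have to be computed.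
\<close>

definition phase_eq :: "'a::cstar_algebra \<Rightarrow> 'a \<Rightarrow> bool" where
  "phase_eq x y \<longleftrightarrow> (\<exists>c. cmod c = 1 \<and> x = c *\<^sub>C y)"

lemma phase_eq_refl [simp]: "phase_eq x x"
  unfolding phase_eq_def by (rule exI[of _ 1]) simp

lemma phase_eq_sym: "phase_eq x y \<Longrightarrow> phase_eq y x"
proof -
  assume "phase_eq x y"
  then obtain c where c: "cmod c = 1" "x = c *\<^sub>C y"
    unfolding phase_eq_def by blast
  then have "c \<noteq> 0"
    by auto
  with c have "cmod (inverse c) = 1" "y = inverse c *\<^sub>C x"
    by (auto simp: scaleC_scaleC norm_inverse)
  then show ?thesis
    unfolding phase_eq_def by blast
qed

lemma phase_eq_trans [trans]:
  assumes "phase_eq x y" "phase_eq y z"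
  shows "phase_eq x z"
proof -
  from assms obtain c d where "cmod c = 1" "x = c *\<^sub>C y" "cmod d = 1" "y = d *\<^sub>C z"
    unfolding phase_eq_def by blast
  then have "cmod (c * d) = 1" "x = (c * d) *\<^sub>C z"
    by (auto simp: norm_mult scaleC_scaleC)
  then show ?thesis
    unfolding phase_eq_def by blast
qed

lemma phase_eq_mult:
  assumes "phase_eq x x'" "phase_eq y y'"
  shows "phase_eq (x * y) (x' * y')"
proof -
  from assms obtain c d where "cmod c = 1" "x = c *\<^sub>C x'" "cmod d = 1" "y = d *\<^sub>C y'"
    unfolding phase_eq_def by blast
  then have "cmod (c * d) = 1" "x * y = (c * d) *\<^sub>C (x' * y')"
    by (auto simp: norm_mult scaleC_scaleC mult_scaleC_left mult_scaleC_right mult.commute[of c d])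
  then show ?thesis
    unfolding phase_eq_def by blast
qed

definition phase_commute :: "'a::cstar_algebra \<Rightarrow> 'a \<Rightarrow> bool" where
  "phase_commute x y \<longleftrightarrow> phase_eq (x * y) (y * x)"

lemma phase_commute_sym: "phase_commute x y \<Longrightarrow> phase_commute y x"
  unfolding phase_commute_def by (rule phase_eq_sym)

lemma phase_commute_mult:
  assumes x: "phase_commute x z" and y: "phase_commute y z"
  shows "phase_commute (x * y) z"
proof -
  have "phase_eq (x * y * z) (x * (z * y))"
    using phase_eq_mult[OF phase_eq_refl[of x] y[unfolded phase_commute_def]] by (simp add: mult.assoc)
  also have "phase_eq (x * (z * y)) (z * (x * y))"
    using phase_eq_mult[OF x[unfolded phase_commute_def] phase_eq_refl[of y]] by (simp add: mult.assoc)
  finally show ?thesis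
    by (simp add: phase_commute_def)
qed

lemma phase_commute_power: "phase_commute x z \<Longrightarrow> phase_commute (x ^ n) z"
  by (induction n) (simp_all add: phase_commute_mult, simp add: phase_commute_def)

lemma phase_commute_star:
  assumes "unitary u" and "phase_commute u z"
  shows "phase_commute (star u) z"
proof -
  have "phase_eq (star u * (z * u) * star u) (star u * (u * z) * star u)"
    by (rule phase_eq_mult[OF phase_eq_mult[OF phase_eq_refl] phase_eq_refl])
       (rule phase_commute_sym[OF assms(2), unfolded phase_commute_def])
  moreover have "star u * (z * u) * star u = star u * z * (u * star u)"
    "star u * (u * z) * star u = star u * u * (z * star u)"
    by (simp_all add: mult.assoc)
  ultimately show ?thesis
    using assms(1) by (simp add: phase_commute_def unitary_def)
qed

lemma phase_commute_upow:
  assumes "unitary u" "unitary v" "phase_commute u v"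
  shows "phase_commute (upow u m) (upow v n)"
proof -
  have left: "phase_commute (upow u m) z" if "unitary u" "phase_commute u z" for u z :: 'a and m
    using that by (simp add: upow_def phase_commute_power phase_commute_star)
  show ?thesis
    using assms by (intro left phase_commute_sym[OF left]) (auto intro: phase_commute_sym)
qed

text \<open>
  Moves one factor \<open>x\<close> past \<open>q\<close>; three applications sort a product of two monomials.
\<close>

lemma phase_eq_interchange:
  assumes "phase_commute x q" and "phase_eq (p * q) r"
  shows "phase_eq ((p * x) * (q * y)) (r * (x * y))"
proof -
  have "phase_eq (p * (x * q) * y) (p * (q * x) * y)"
    by (rule phase_eq_mult[OF phase_eq_mult[OF phase_eq_refl] phase_eq_refl])
       (rule assms(1)[unfolded phase_commute_def])
  also have "p * (q * x) * y = (p * q) * (x * y)"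
    by (simp add: mult.assoc)
  also have "phase_eq \<dots> (r * (x * y))"
    by (intro phase_eq_mult assms(2) phase_eq_refl)
  finally show ?thesis
    by (simp add: mult.assoc)
qed

context
  fixes \<Theta> :: "real^4^4" and U :: "4 \<Rightarrow> 'a::cstar_algebra"
  assumes U: "torus_unitaries \<Theta> U"
begin

lemma unitary_generator: "unitary (U j)"
  using U unfolding torus_unitaries_def unitary_def by blast

lemma phase_commute_generators: "phase_commute (U i) (U j)"
proof -
  have "U i * U j = exp (2 * pi * \<i> * \<Theta> $ i $ j) *\<^sub>C (U j * U i)"
    using U unfolding torus_unitaries_def by blast
  then show ?thesis
    unfolding phase_commute_def phase_eq_def
    by (intro exI[of _ "exp (2 * pi * \<i> * \<Theta> $ i $ j)"]) simp
qed

lemma norm_torus_monomial_le: "norm (torus_monomial U k) \<le> 1"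
proof -
  have mult: "norm (x * y) \<le> 1" if "norm x \<le> 1" "norm y \<le> 1" for x y :: 'a
    using norm_mult_ineq[of x y] mult_le_one[of "norm x" "norm y"] that by simp
  show ?thesis
    unfolding torus_monomial_def by (intro mult norm_upow_le unitary_generator)
qed

lemma torus_monomial_mult: "phase_eq (torus_monomial U k * torus_monomial U l) (torus_monomial U (k + l))"
proof -
  have c: "phase_commute (upow (U i) m) (upow (U j) n)" for i j m n
    by (intro phase_commute_upow unitary_generator phase_commute_generators)
  have c2: "phase_commute (upow (U i) m) (upow (U j) n * upow (U j') n')" for i j j' m n n'
    by (rule phase_commute_sym[OF phase_commute_mult]) (rule c)+
  have c3: "phase_commute (upow (U i) m) (upow (U j) n * upow (U j') n' * upow (U j'') n'')"
    for i j j' j'' m n n' n''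
    by (rule phase_commute_sym[OF phase_commute_mult]) (rule phase_commute_sym[OF c2] c)+
  show ?thesis
    unfolding torus_monomial_def vector_add_component upow_add[OF unitary_generator]
    by (rule phase_eq_interchange[OF c3 phase_eq_interchange[OF c2
          phase_eq_interchange[OF c phase_eq_refl]]])
qed

end

lemma torus_monomial_0 [simp]: "torus_monomial U 0 = 1"
  by (simp add: torus_monomial_def)

section \<open>Rapidly decreasing families and their regrouping\<close>

definition weight :: "int^4 \<Rightarrow> real" where
  "weight k = 1 + (\<Sum>j\<in>UNIV. \<bar>real_of_int (k $ j)\<bar>)"

lemma weight_ge_1: "1 \<le> weight k"
  by (simp add: weight_def sum_nonneg)

lemma weight_nonneg: "0 \<le> weight k"
  using weight_ge_1[of k] by simp

lemma weight_0 [simp]: "weight 0 = 1"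
  by (simp add: weight_def)

lemma weight_add_le: "weight (k + l) \<le> weight k * weight l"
proof -
  let ?n = "\<lambda>k :: int^4. \<Sum>j\<in>UNIV. \<bar>real_of_int (k $ j)\<bar>"
  have "?n (k + l) \<le> ?n k + ?n l"
    unfolding sum.distrib[symmetric] by (rule sum_mono) simp
  moreover have "0 \<le> ?n k * ?n l"
    by (intro mult_nonneg_nonneg sum_nonneg) auto
  ultimately have "weight (k + l) \<le> 1 + (?n k + ?n l) + ?n k * ?n l"
    unfolding weight_def by linarith
  also have "\<dots> = weight k * weight l"
    by (simp add: weight_def algebra_simps)
  finally show ?thesis .
qed

lemma decay_weight_eq: "decay_weight N a k = weight k ^ N * cmod (a k)"
  by (simp add: decay_weight_def weight_def)

lemma inverse_square_summable_on_int: "(\<lambda>n. 1 / (1 + \<bar>real_of_int n\<bar>) ^ 2) summable_on UNIV"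
proof -
  let ?g = "\<lambda>n. 1 / (1 + \<bar>real_of_int n\<bar>) ^ 2"
  have "summable (\<lambda>n. inverse (real (Suc n) ^ 2))"
    by (rule iffD2[OF summable_Suc_iff inverse_power_summable]) simp
  then have "summable (\<lambda>n. 1 / (1 + real n) ^ 2)"
    by (simp add: inverse_eq_divide)
  then have nat: "(\<lambda>n. 1 / (1 + real n) ^ 2) summable_on UNIV"
    by (intro summable_nonneg_imp_summable_on) auto
  then have "?g summable_on range int"
    by (subst summable_on_reindex) (auto simp: o_def)
  moreover have "?g summable_on range (\<lambda>n. - int n)"
    using nat by (subst summable_on_reindex) (auto simp: o_def inj_def)
  ultimately have "?g summable_on range int \<union> range (\<lambda>n. - int n)"
    by (rule summable_on_union)
  moreover have "n \<in> range int \<union> range (\<lambda>n. - int n)" for n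
    by (cases n rule: int_cases2) auto
  then have "range int \<union> range (\<lambda>n. - int n) = UNIV"
    by blast
  ultimately show ?thesis
    by simp
qed

text \<open>
  \<open>weight k ^ 8\<close> is at least the product of \<open>(1 + |k\<^sub>j|)\<^sup>2\<close> over the four coordinates, so the sum is bounded
  by the fourth power of a convergent sum over the integers.
\<close>

lemma weight_power_summable: "(\<lambda>k. 1 / weight k ^ 8) summable_on UNIV"
proof -
  define g where "g n = 1 / (1 + \<bar>real_of_int n\<bar>) ^ 2" for n
  define h where "h k = (k $ 1, k $ 2, k $ 3, k $ 4)" for k :: "int^4"
  define G where "G = (\<lambda>(a, b, c, d). g a * (g b * (g c * g d)))"
  have g: "(\<lambda>n. norm (g n)) summable_on UNIV"
    using inverse_square_summable_on_int by (simp add: g_def)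
  have pair: "(\<lambda>p. norm (case p of (n, q) \<Rightarrow> g n * u q)) summable_on UNIV"
    if "(\<lambda>q. norm (u q)) summable_on UNIV" for u :: "'q \<Rightarrow> real"
    using abs_summable_on_mult[OF g that] by (simp add: case_prod_unfold)
  have "(\<lambda>p. norm (G p)) summable_on UNIV"
    using pair[OF pair[OF pair[OF g]]] by (simp add: G_def case_prod_unfold)
  moreover have "inj h"
    by (auto simp: h_def inj_def vec_eq_iff forall_4)
  ultimately have "(\<lambda>k. norm (G (h k))) summable_on UNIV"
    using summable_on_subset[of "\<lambda>p. norm (G p)" UNIV "range h"] summable_on_reindex[of h UNIV "\<lambda>p. norm (G p)"]
    by (simp add: o_def)
  then show ?thesis
  proof (rule summable_on_comparison_test)
    fix k :: "int^4"
    have "1 + \<bar>real_of_int (k $ j)\<bar> \<le> weight k" for j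
      unfolding weight_def using member_le_sum[of j UNIV "\<lambda>j. \<bar>real_of_int (k $ j)\<bar>"] by simp
    then have le: "1 / weight k ^ 2 \<le> g (k $ j)" for j
      unfolding g_def by (intro divide_left_mono power_mono mult_pos_pos zero_less_power)
        (use weight_ge_1[of k] in auto)
    have nonneg: "0 \<le> 1 / weight k ^ 2" "0 \<le> g n" for n
      by (auto simp: g_def)
    have "1 / weight k ^ 8 = 1 / weight k ^ 2 * (1 / weight k ^ 2 * (1 / weight k ^ 2 * (1 / weight k ^ 2)))"
      by (simp add: power_add[symmetric])
    also have "\<dots> \<le> g (k $ 1) * (g (k $ 2) * (g (k $ 3) * g (k $ 4)))"
      by (intro mult_mono le mult_nonneg_nonneg nonneg)
    also have "\<dots> \<le> norm (G (h k))"
      by (simp add: G_def h_def)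
    finally show "1 / weight k ^ 8 \<le> norm (G (h k))" .
  qed (use weight_nonneg in auto)
qed

text \<open>
  The terms of the family are \<open>c i\<close> times the monomial with exponent \<open>\<kappa> i\<close>. Different indices may have
  the same exponent, so that products (indexed by pairs) and sums of series need no collecting of terms
  until \<open>fiber_sum\<close> does it once and for all.
\<close>

definition rapid_family :: "('i \<Rightarrow> complex) \<Rightarrow> ('i \<Rightarrow> int^4) \<Rightarrow> bool" where
  "rapid_family c \<kappa> \<longleftrightarrow> (\<forall>N. (\<lambda>i. weight (\<kappa> i) ^ N * cmod (c i)) summable_on UNIV)"

text \<open>
  A supremum bound with weight exponent \<open>N + 8\<close> gives summability with exponent \<open>N\<close>.
\<close>

lemma rapidly_decreasing_iff_rapid_family: "rapidly_decreasing a \<longleftrightarrow> rapid_family a (\<lambda>k. k)"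
proof
  assume a: "rapidly_decreasing a"
  show "rapid_family a (\<lambda>k. k)"
    unfolding rapid_family_def
  proof
    fix N
    obtain B where B: "\<And>k. decay_weight (N + 8) a k \<le> B"
      using a unfolding rapidly_decreasing_def bdd_above_def by fast
    have "(\<lambda>k. B * (1 / weight k ^ 8)) summable_on UNIV"
      by (intro summable_on_cmult_right weight_power_summable)
    then show "(\<lambda>k. weight k ^ N * cmod (a k)) summable_on UNIV"
    proof (rule summable_on_comparison_test)
      fix k
      have "0 < weight k ^ 8"
        using weight_ge_1[of k] by simp
      then show "weight k ^ N * cmod (a k) \<le> B * (1 / weight k ^ 8)"
        using B[of k] by (simp add: decay_weight_eq field_simps power_add)
    qed (simp add: weight_nonneg)
  qed
next
  assume "rapid_family a (\<lambda>k. k)"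
  then have "decay_weight N a k \<le> (\<Sum>\<^sub>\<infinity>k. weight k ^ N * cmod (a k))" for N k
    unfolding rapid_family_def decay_weight_eq
    using finite_sum_le_infsum[of "\<lambda>k. weight k ^ N * cmod (a k)" UNIV "{k}"] by (simp add: weight_nonneg)
  then show "rapidly_decreasing a"
    unfolding rapidly_decreasing_def by (intro allI bdd_aboveI2)
qed

lemma rapid_family_imp_norm_summable:
  assumes "rapid_family c \<kappa>"
  shows "(\<lambda>i. norm (c i)) summable_on UNIV"
  using assms[unfolded rapid_family_def, rule_format, of 0] by simp

lemma rapid_family_multiplier:
  assumes c: "rapid_family c \<kappa>" and p: "\<And>k. cmod (p k) \<le> C * weight k ^ M"
  shows "rapid_family (\<lambda>i. p (\<kappa> i) * c i) \<kappa>"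
  unfolding rapid_family_def
proof
  fix N
  have "(\<lambda>i. C * (weight (\<kappa> i) ^ (N + M) * cmod (c i))) summable_on UNIV"
    using c by (intro summable_on_cmult_right) (simp add: rapid_family_def)
  then show "(\<lambda>i. weight (\<kappa> i) ^ N * cmod (p (\<kappa> i) * c i)) summable_on UNIV"
  proof (rule summable_on_comparison_test)
    fix i
    have "weight (\<kappa> i) ^ N * (cmod (p (\<kappa> i)) * cmod (c i))
        \<le> weight (\<kappa> i) ^ N * ((C * weight (\<kappa> i) ^ M) * cmod (c i))"
      by (intro mult_left_mono mult_right_mono p) (auto simp: weight_nonneg)
    then show "weight (\<kappa> i) ^ N * cmod (p (\<kappa> i) * c i) \<le> C * (weight (\<kappa> i) ^ (N + M) * cmod (c i))"
      by (simp add: norm_mult power_add mult_ac)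
  qed (simp add: weight_nonneg)
qed

definition fiber_sum :: "('i \<Rightarrow> 'k) \<Rightarrow> ('i \<Rightarrow> 'a::banach) \<Rightarrow> 'k \<Rightarrow> 'a" where
  "fiber_sum \<kappa> c k = (\<Sum>\<^sub>\<infinity>i\<in>{i. \<kappa> i = k}. c i)"

lemma fiber_sum_has_sum:
  assumes "(g has_sum S) UNIV"
  shows "(fiber_sum \<kappa> g has_sum S) UNIV"
proof -
  have "(g has_sum S) UNIV \<longleftrightarrow> ((g \<circ> snd) has_sum S) (Sigma UNIV (\<lambda>k. {i. \<kappa> i = k}))"
    by (rule has_sum_reindex_bij_witness[where i = snd and j = "\<lambda>i. (\<kappa> i, i)"]) auto
  then have "((g \<circ> snd) has_sum S) (Sigma UNIV (\<lambda>k. {i. \<kappa> i = k}))"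
    using assms by simp
  then show ?thesis
  proof (rule has_sum_SigmaD)
    show "((\<lambda>i. (g \<circ> snd) (k, i)) has_sum fiber_sum \<kappa> g k) {i. \<kappa> i = k}" for k
      using summable_on_subset_banach[OF has_sum_imp_summable[OF assms], of "{i. \<kappa> i = k}"]
      by (simp add: fiber_sum_def)
  qed
qed

lemma fiber_sum_multiplier:
  "fiber_sum \<kappa> (\<lambda>i. p (\<kappa> i) * c i) k = p k * fiber_sum \<kappa> (c :: _ \<Rightarrow> complex) k"
proof -
  have "fiber_sum \<kappa> (\<lambda>i. p (\<kappa> i) * c i) k = (\<Sum>\<^sub>\<infinity>i\<in>{i. \<kappa> i = k}. p k * c i)"
    unfolding fiber_sum_def by (rule infsum_cong) auto
  then show ?thesis
    by (simp add: fiber_sum_def infsum_cmult_right')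
qed

lemma weighted_fiber_sum_le:
  assumes c: "rapid_family c \<kappa>"
  shows "(\<lambda>k. weight k ^ N * cmod (fiber_sum \<kappa> c k)) summable_on UNIV" (is ?A)
    and "(\<Sum>\<^sub>\<infinity>k. weight k ^ N * cmod (fiber_sum \<kappa> c k)) \<le> (\<Sum>\<^sub>\<infinity>i. weight (\<kappa> i) ^ N * cmod (c i))" (is ?B)
proof -
  let ?g = "\<lambda>i. weight (\<kappa> i) ^ N * cmod (c i)"
  have "(?g has_sum infsum ?g UNIV) UNIV"
    using c by (simp add: rapid_family_def)
  from fiber_sum_has_sum[OF this, of \<kappa>]
  have sum: "(fiber_sum \<kappa> ?g has_sum infsum ?g UNIV) UNIV" .
  have le: "weight k ^ N * cmod (fiber_sum \<kappa> c k) \<le> fiber_sum \<kappa> ?g k" for k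
  proof -
    have "(\<lambda>i. norm (c i)) summable_on {i. \<kappa> i = k}"
      using rapid_family_imp_norm_summable[OF c] by (rule summable_on_subset_banach) simp
    then have "weight k ^ N * cmod (fiber_sum \<kappa> c k) \<le> weight k ^ N * (\<Sum>\<^sub>\<infinity>i\<in>{i. \<kappa> i = k}. cmod (c i))"
      unfolding fiber_sum_def by (intro mult_left_mono norm_infsum_bound) (auto simp: weight_nonneg)
    also have "\<dots> = (\<Sum>\<^sub>\<infinity>i\<in>{i. \<kappa> i = k}. weight k ^ N * cmod (c i))"
      by (simp add: infsum_cmult_right')
    also have "\<dots> = fiber_sum \<kappa> ?g k"
      unfolding fiber_sum_def by (rule infsum_cong) auto
    finally show ?thesis .
  qed
  show ?A
    by (rule summable_on_comparison_test[OF has_sum_imp_summable[OF sum] le]) (simp add: weight_nonneg)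
  then show ?B
    by (intro has_sum_mono[OF has_sum_infsum sum le])
qed

lemma rapidly_decreasing_fiber_sum: "rapid_family c \<kappa> \<Longrightarrow> rapidly_decreasing (fiber_sum \<kappa> c)"
  unfolding rapidly_decreasing_iff_rapid_family using weighted_fiber_sum_le(1)
  by (auto simp: rapid_family_def)

section \<open>The smooth algebra\<close>

definition torus_sum :: "(4 \<Rightarrow> 'a::cstar_algebra) \<Rightarrow> ('i \<Rightarrow> complex) \<Rightarrow> ('i \<Rightarrow> int^4) \<Rightarrow> 'a" where
  "torus_sum U c \<kappa> = (\<Sum>\<^sub>\<infinity>i. c i *\<^sub>C torus_monomial U (\<kappa> i))"

lemma fourier_eq_torus_sum: "fourier U a = torus_sum U a (\<lambda>k. k)"
  by (simp add: fourier_def torus_sum_def)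

lemma rapid_family_finite_support:
  assumes "finite F" and "\<And>i. i \<notin> F \<Longrightarrow> c i = 0"
  shows "rapid_family c \<kappa>"
  unfolding rapid_family_def
  by (intro allI finite_nonzero_values_imp_summable_on finite_subset[OF _ assms(1)]) (use assms(2) in auto)

lemma rapidly_decreasing_finite_support:
  "finite F \<Longrightarrow> (\<And>k. k \<notin> F \<Longrightarrow> a k = 0) \<Longrightarrow> rapidly_decreasing a"
  unfolding rapidly_decreasing_iff_rapid_family by (rule rapid_family_finite_support)

lemma rapidly_decreasing_add:
  assumes "rapidly_decreasing a" "rapidly_decreasing b"
  shows "rapidly_decreasing (\<lambda>k. a k + b k)"
  unfolding rapidly_decreasing_iff_rapid_family rapid_family_def
proof
  fix N
  have "(\<lambda>k. weight k ^ N * cmod (a k) + weight k ^ N * cmod (b k)) summable_on UNIV"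
    using assms unfolding rapidly_decreasing_iff_rapid_family rapid_family_def by (intro summable_on_add) auto
  then show "(\<lambda>k. weight k ^ N * cmod (a k + b k)) summable_on UNIV"
    by (rule summable_on_comparison_test)
       (auto simp: distrib_left[symmetric] weight_nonneg intro!: mult_left_mono norm_triangle_ineq)
qed

lemma rapidly_decreasing_multiplier:
  assumes "rapidly_decreasing a" and "\<And>k. cmod (p k) \<le> C * weight k ^ M"
  shows "rapidly_decreasing (\<lambda>k. p k * a k)"
  using rapid_family_multiplier[of a "\<lambda>k. k"] assms unfolding rapidly_decreasing_iff_rapid_family by blast

context
  fixes \<Theta> :: "real^4^4" and U :: "4 \<Rightarrow> 'a::cstar_algebra"
  assumes U: "torus_unitaries \<Theta> U"
begin

lemma norm_torus_term_le: "norm (c *\<^sub>C torus_monomial U k) \<le> cmod c"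
  using mult_left_mono[OF norm_torus_monomial_le[OF U, of k], of "cmod c"] by (simp add: norm_scaleC)

lemma torus_sum_abs_summable:
  assumes "rapid_family c \<kappa>"
  shows "(\<lambda>i. norm (c i *\<^sub>C torus_monomial U (\<kappa> i))) summable_on UNIV"
  by (rule summable_on_comparison_test[OF rapid_family_imp_norm_summable[OF assms] norm_torus_term_le]) simp

lemma torus_sum_has_sum:
  assumes "rapid_family c \<kappa>"
  shows "((\<lambda>i. c i *\<^sub>C torus_monomial U (\<kappa> i)) has_sum torus_sum U c \<kappa>) UNIV"
  unfolding torus_sum_def by (rule has_sum_infsum[OF abs_summable_summable[OF torus_sum_abs_summable[OF assms]]])

lemma fourier_has_sum:
  "rapidly_decreasing a \<Longrightarrow> ((\<lambda>k. a k *\<^sub>C torus_monomial U k) has_sum fourier U a) UNIV"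
  unfolding rapidly_decreasing_iff_rapid_family fourier_eq_torus_sum by (rule torus_sum_has_sum)

lemma fourier_finite_support:
  assumes "finite F" and "\<And>k. k \<notin> F \<Longrightarrow> a k = 0"
  shows "fourier U a = (\<Sum>k\<in>F. a k *\<^sub>C torus_monomial U k)"
proof -
  have "((\<lambda>k. a k *\<^sub>C torus_monomial U k) has_sum (\<Sum>k\<in>F. a k *\<^sub>C torus_monomial U k)) UNIV"
    by (rule has_sum_finite_neutralI) (use assms in auto)
  then show ?thesis
    by (simp add: fourier_def infsumI)
qed

lemma fourier_add:
  assumes "rapidly_decreasing a" "rapidly_decreasing b"
  shows "fourier U (\<lambda>k. a k + b k) = fourier U a + fourier U b"
  using has_sum_add[OF fourier_has_sum[OF assms(1)] fourier_has_sum[OF assms(2)]]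
  by (simp add: fourier_def infsumI scaleC_add_left)

lemma torus_sum_eq_fourier:
  assumes c: "rapid_family c \<kappa>"
  shows "torus_sum U c \<kappa> = fourier U (fiber_sum \<kappa> c)"
proof -
  let ?t = "\<lambda>i. c i *\<^sub>C torus_monomial U (\<kappa> i)"
  have "fiber_sum \<kappa> ?t k = fiber_sum \<kappa> c k *\<^sub>C torus_monomial U k" for k
  proof -
    have "(\<lambda>i. norm (c i)) summable_on {i. \<kappa> i = k}"
      using rapid_family_imp_norm_summable[OF c] by (rule summable_on_subset_banach) simp
    then have "(c has_sum fiber_sum \<kappa> c k) {i. \<kappa> i = k}"
      unfolding fiber_sum_def by (rule has_sum_infsum[OF abs_summable_summable])
    then have "((\<lambda>i. c i *\<^sub>C torus_monomial U k) has_sum fiber_sum \<kappa> c k *\<^sub>C torus_monomial U k) {i. \<kappa> i = k}"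
      by (rule has_sum_bounded_linear[OF bounded_linear_scaleC_left])
    also have "?this \<longleftrightarrow> (?t has_sum fiber_sum \<kappa> c k *\<^sub>C torus_monomial U k) {i. \<kappa> i = k}"
      by (rule has_sum_cong) auto
    finally show ?thesis
      unfolding fiber_sum_def[of \<kappa> ?t] by (rule infsumI)
  qed
  then have eq: "fiber_sum \<kappa> ?t = (\<lambda>k. fiber_sum \<kappa> c k *\<^sub>C torus_monomial U k)"
    by (rule ext)
  show ?thesis
    using infsumI[OF fiber_sum_has_sum[OF torus_sum_has_sum[OF c], of \<kappa>]] unfolding eq fourier_def by simp
qed

lemma smooth_torus_add:
  assumes "x \<in> smooth_torus U" "y \<in> smooth_torus U"
  shows "x + y \<in> smooth_torus U"
proof -
  obtain a b where a: "rapidly_decreasing a" "x = fourier U a" and b: "rapidly_decreasing b" "y = fourier U b"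
    using assms by (auto simp: smooth_torus_def)
  then have "x + y = fourier U (\<lambda>k. a k + b k)" "rapidly_decreasing (\<lambda>k. a k + b k)"
    by (simp_all add: fourier_add rapidly_decreasing_add)
  then show ?thesis
    unfolding smooth_torus_def by blast
qed

lemma torus_monomial_smooth: "torus_monomial U k \<in> smooth_torus U"
proof -
  let ?a = "\<lambda>l. if l = k then 1 else 0 :: complex"
  have "fourier U ?a = torus_monomial U k"
    by (subst fourier_finite_support[of "{k}"]) auto
  moreover have "rapidly_decreasing ?a"
    by (rule rapidly_decreasing_finite_support[of "{k}"]) auto
  ultimately show ?thesis
    unfolding smooth_torus_def by (metis (mono_tags, lifting) imageI mem_Collect_eq)
qed

lemma smooth_torus_1: "1 \<in> smooth_torus U"
  using torus_monomial_smooth[of 0] by simp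

text \<open>
  The product of the series is indexed by pairs \<open>(k, l)\<close>, has exponent \<open>k + l\<close>, and its coefficients
  are those of the factors up to a phase. Submultiplicativity of the weight makes each weighted
  \<open>\<ell>\<^sup>1\<close> norm submultiplicative.
\<close>

lemma fourier_mult_exists:
  assumes a: "rapidly_decreasing a" and b: "rapidly_decreasing b"
  obtains ab where "rapidly_decreasing ab" "fourier U ab = fourier U a * fourier U b"
    and "\<And>N. (\<Sum>\<^sub>\<infinity>k. weight k ^ N * cmod (ab k))
      \<le> (\<Sum>\<^sub>\<infinity>k. weight k ^ N * cmod (a k)) * (\<Sum>\<^sub>\<infinity>k. weight k ^ N * cmod (b k))"
proof -
  have "\<exists>z. cmod z = 1 \<and> torus_monomial U k * torus_monomial U l = z *\<^sub>C torus_monomial U (k + l)" for k l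
    using torus_monomial_mult[OF U, of k l] by (simp add: phase_eq_def)
  then obtain z where z: "\<And>k l. cmod (z k l) = 1"
    "\<And>k l. torus_monomial U k * torus_monomial U l = z k l *\<^sub>C torus_monomial U (k + l)"
    by metis
  define c where "c = (\<lambda>(k, l). a k * b l * z k l)"
  define \<kappa> where "\<kappa> = (\<lambda>(k, l). k + l :: int^4)"
  have sum: "(\<lambda>k. norm (weight k ^ N * cmod (a k))) summable_on UNIV"
    "(\<lambda>k. norm (weight k ^ N * cmod (b k))) summable_on UNIV" for N
    using a b by (simp_all add: rapidly_decreasing_iff_rapid_family rapid_family_def weight_nonneg abs_mult)
  let ?P = "\<lambda>N p. case p of (k, l) \<Rightarrow> (weight k ^ N * cmod (a k)) * (weight l ^ N * cmod (b l))"
  have P: "(?P N has_sum (\<Sum>\<^sub>\<infinity>k. weight k ^ N * cmod (a k)) * (\<Sum>\<^sub>\<infinity>k. weight k ^ N * cmod (b k))) UNIV" for N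
    using has_sum_mult[OF sum[of N]] by simp
  have le: "weight (\<kappa> p) ^ N * cmod (c p) \<le> ?P N p" for N p
  proof -
    obtain k l where p: "p = (k, l)"
      by fastforce
    have "weight (k + l) ^ N * cmod (c p) \<le> (weight k * weight l) ^ N * cmod (c p)"
      by (intro mult_right_mono power_mono weight_add_le) (auto simp: weight_nonneg)
    then show ?thesis
      by (simp add: p \<kappa>_def c_def norm_mult z power_mult_distrib mult_ac)
  qed
  have rapid: "rapid_family c \<kappa>"
    unfolding rapid_family_def
    by (intro allI summable_on_comparison_test[OF has_sum_imp_summable[OF P] le])
       (simp add: weight_nonneg)
  have "((\<lambda>(k, l). (a k *\<^sub>C torus_monomial U k) * (b l *\<^sub>C torus_monomial U l))
      has_sum fourier U a * fourier U b) UNIV"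
    using has_sum_mult[OF torus_sum_abs_summable torus_sum_abs_summable, of a "\<lambda>k. k" b "\<lambda>k. k"] a b
    by (simp add: rapidly_decreasing_iff_rapid_family fourier_def)
  also have "(\<lambda>(k, l). (a k *\<^sub>C torus_monomial U k) * (b l *\<^sub>C torus_monomial U l))
      = (\<lambda>p. c p *\<^sub>C torus_monomial U (\<kappa> p))"
    by (auto simp: fun_eq_iff c_def \<kappa>_def mult_scaleC_left mult_scaleC_right z(2) scaleC_scaleC mult_ac)
  finally have "fourier U a * fourier U b = torus_sum U c \<kappa>"
    by (simp add: torus_sum_def infsumI)
  also have "\<dots> = fourier U (fiber_sum \<kappa> c)"
    by (rule torus_sum_eq_fourier[OF rapid])
  finally have prod: "fourier U (fiber_sum \<kappa> c) = fourier U a * fourier U b" ..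
  have "(\<Sum>\<^sub>\<infinity>k. weight k ^ N * cmod (fiber_sum \<kappa> c k))
      \<le> (\<Sum>\<^sub>\<infinity>k. weight k ^ N * cmod (a k)) * (\<Sum>\<^sub>\<infinity>k. weight k ^ N * cmod (b k))" for N
    using weighted_fiber_sum_le(2)[OF rapid] rapid[unfolded rapid_family_def]
      has_sum_mono[OF has_sum_infsum P le] by (meson order_trans)
  then show ?thesis
    by (rule that[OF rapidly_decreasing_fiber_sum[OF rapid] prod])
qed

lemma smooth_torus_mult:
  assumes "x \<in> smooth_torus U" "y \<in> smooth_torus U"
  shows "x * y \<in> smooth_torus U"
proof -
  obtain a b where a: "rapidly_decreasing a" "x = fourier U a" and b: "rapidly_decreasing b" "y = fourier U b"
    using assms by (auto simp: smooth_torus_def)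
  obtain ab where "rapidly_decreasing ab" "fourier U ab = fourier U a * fourier U b"
    using fourier_mult_exists[OF a(1) b(1)] by blast
  then have "x * y = fourier U ab" "rapidly_decreasing ab"
    by (simp_all add: a b)
  then show ?thesis
    unfolding smooth_torus_def by blast
qed

lemma smooth_torus_power: "x \<in> smooth_torus U \<Longrightarrow> x ^ n \<in> smooth_torus U"
  by (induction n) (auto intro: smooth_torus_1 smooth_torus_mult)

end

section \<open>Power series of the exponential in the smooth algebra\<close>

text \<open>
  The factor by which \<open>\<delta> j\<close> multiplies the \<open>k\<close>-th Fourier coefficient.
\<close>

definition symbol :: "4 \<Rightarrow> int^4 \<Rightarrow> complex" where
  "symbol j k = 2 * pi * \<i> * of_int (k $ j)"

lemma symbol_growth: "cmod (symbol j k) \<le> 2 * pi * weight k ^ 1"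
proof -
  have "\<bar>real_of_int (k $ j)\<bar> \<le> weight k"
    unfolding weight_def using member_le_sum[of j UNIV "\<lambda>j. \<bar>real_of_int (k $ j)\<bar>"] by simp
  then show ?thesis
    by (simp add: symbol_def norm_mult)
qed

context
  fixes \<Theta> :: "real^4^4" and U :: "4 \<Rightarrow> 'a::cstar_algebra"
  assumes U: "torus_unitaries \<Theta> U"
begin

lemma fourier_powers_exist:
  assumes a: "rapidly_decreasing a"
  shows "\<exists>A. \<forall>n. rapidly_decreasing (A n) \<and> fourier U (A n) = fourier U a ^ n
    \<and> (\<forall>N. (\<Sum>\<^sub>\<infinity>k. weight k ^ N * cmod (A n k)) \<le> (\<Sum>\<^sub>\<infinity>k. weight k ^ N * cmod (a k)) ^ n)"
proof -
  let ?W = "\<lambda>N a. \<Sum>\<^sub>\<infinity>k. weight k ^ N * cmod (a k)"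
  have W_nonneg: "0 \<le> ?W N b" for N b
    by (intro infsum_nonneg) (simp add: weight_nonneg)
  have "\<exists>b. rapidly_decreasing b \<and> fourier U b = fourier U a ^ n \<and> (\<forall>N. ?W N b \<le> ?W N a ^ n)" for n
  proof (induction n)
    case 0
    let ?e = "\<lambda>k. if k = 0 then 1 else 0 :: complex"
    have "rapidly_decreasing ?e"
      by (rule rapidly_decreasing_finite_support[of "{0}"]) auto
    moreover have "fourier U ?e = 1"
      by (subst fourier_finite_support[OF U, of "{0}"]) auto
    moreover have "?W N ?e = 1" for N
      by (rule infsumI, rule has_sum_finite_neutralI[of "{0}"]) auto
    ultimately show ?case
      by (intro exI[of _ ?e]) simp
  next
    case (Suc n)
    then obtain b where b: "rapidly_decreasing b" "fourier U b = fourier U a ^ n" "\<And>N. ?W N b \<le> ?W N a ^ n"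
      by blast
    obtain c where c: "rapidly_decreasing c" "fourier U c = fourier U a * fourier U b"
      "\<And>N. ?W N c \<le> ?W N a * ?W N b"
      using fourier_mult_exists[OF U a b(1)] by blast
    have "?W N c \<le> ?W N a ^ Suc n" for N
      using order_trans[OF c(3)[of N] mult_left_mono[OF b(3)[of N] W_nonneg]] by simp
    then show ?case
      using c b(2) by (intro exI[of _ c]) simp
  qed
  then show ?thesis
    by (intro choice allI)
qed

text \<open>
  The double family of terms \<open>A n k / n!\<close> is rapidly decreasing because its weighted \<open>\<ell>\<^sup>1\<close> norms are
  at most \<open>exp (B N)\<close>. Collecting it by \<open>k\<close> gives the Fourier coefficients of \<open>exp f\<close>, collecting it by \<open>n\<close>
  gives the exponential series. A multiplier \<open>p\<close> of polynomial growth preserves rapid decrease, so the two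
  summations still agree after multiplication by \<open>p\<close>; this is what replaces continuity of \<open>D \<circ> D\<close>.
\<close>

lemma exp_fourier_expansion:
  assumes A: "\<And>n. rapidly_decreasing (A n)" "\<And>n. fourier U (A n) = f ^ n"
    and growth: "\<And>n N. (\<Sum>\<^sub>\<infinity>k. weight k ^ N * cmod (A n k)) \<le> B N ^ n"
  shows "\<exists>E. rapidly_decreasing E \<and> exp f = fourier U E \<and>
    (\<forall>p C M. (\<forall>k. cmod (p k) \<le> C * weight k ^ M) \<longrightarrow>
      (\<lambda>n. fourier U (\<lambda>k. p k * A n k) /\<^sub>R fact n) sums fourier U (\<lambda>k. p k * E k))"
proof -
  define c where "c = (\<lambda>(n, k). complex_of_real (inverse (fact n)) * A n k)"
  define \<kappa> where "\<kappa> = (snd :: nat \<times> (int^4) \<Rightarrow> int^4)"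
  have rapid: "rapid_family c \<kappa>"
    unfolding rapid_family_def
  proof
    fix N
    have "(\<lambda>n. (\<Sum>\<^sub>\<infinity>k. weight k ^ N * cmod (A n k)) / fact n) summable_on UNIV"
    proof (rule summable_on_comparison_test)
      show "(\<lambda>n. norm (B N ^ n /\<^sub>R fact n)) summable_on UNIV"
        using summable_norm_exp[of "B N"] by (intro summable_nonneg_imp_summable_on) auto
      show "(\<Sum>\<^sub>\<infinity>k. weight k ^ N * cmod (A n k)) / fact n \<le> norm (B N ^ n /\<^sub>R fact n)" for n
        using divide_right_mono[OF order_trans[OF growth[of N n] abs_ge_self], of "fact n"]
        by (simp add: abs_mult divide_inverse mult.commute)
      show "0 \<le> (\<Sum>\<^sub>\<infinity>k. weight k ^ N * cmod (A n k)) / fact n" for n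
        by (intro divide_nonneg_nonneg infsum_nonneg) (simp_all add: weight_nonneg)
    qed
    then have "(\<lambda>p. weight (snd p) ^ N * cmod (A (fst p) (snd p)) / fact (fst p)) summable_on UNIV \<times> UNIV"
    proof (rule summable_on_SigmaI[rotated])
      fix n :: nat
      have "(\<lambda>k. weight k ^ N * cmod (A n k)) summable_on UNIV"
        using A(1)[of n] by (simp add: rapidly_decreasing_iff_rapid_family rapid_family_def)
      then show "((\<lambda>k. weight (snd (n, k)) ^ N * cmod (A (fst (n, k)) (snd (n, k))) / fact (fst (n, k)))
          has_sum (\<Sum>\<^sub>\<infinity>k. weight k ^ N * cmod (A n k)) / fact n) UNIV"
        by (simp add: has_sum_divide_const)
    qed (simp add: weight_nonneg)
    then show "(\<lambda>p. weight (\<kappa> p) ^ N * cmod (c p)) summable_on UNIV"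
      by (simp add: \<kappa>_def c_def case_prod_unfold norm_mult norm_inverse divide_inverse mult_ac)
  qed
  define E where "E = fiber_sum \<kappa> c"
  have sums: "(\<lambda>n. fourier U (\<lambda>k. p k * A n k) /\<^sub>R fact n) sums fourier U (\<lambda>k. p k * E k)"
    if p: "\<And>k. cmod (p k) \<le> C * weight k ^ M" for p C M
  proof -
    have "torus_sum U (\<lambda>i. p (\<kappa> i) * c i) \<kappa> = fourier U (\<lambda>k. p k * E k)"
      by (simp add: torus_sum_eq_fourier[OF U rapid_family_multiplier[OF rapid p]] E_def
          fiber_sum_multiplier[abs_def])
    then have "((\<lambda>i. (p (\<kappa> i) * c i) *\<^sub>C torus_monomial U (\<kappa> i)) has_sum fourier U (\<lambda>k. p k * E k)) (UNIV \<times> UNIV)"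
      using torus_sum_has_sum[OF U rapid_family_multiplier[OF rapid p]] by simp
    then have "((\<lambda>n. fourier U (\<lambda>k. p k * A n k) /\<^sub>R fact n) has_sum fourier U (\<lambda>k. p k * E k)) UNIV"
    proof (rule has_sum_SigmaD)
      fix n :: nat
      have "((\<lambda>k. (p k * A n k) *\<^sub>C torus_monomial U k) has_sum fourier U (\<lambda>k. p k * A n k)) UNIV"
        by (rule fourier_has_sum[OF U rapidly_decreasing_multiplier[OF A(1) p]])
      from has_sum_bounded_linear[OF bounded_linear_scaleR_right this, of "inverse (fact n)"]
      show "((\<lambda>k. (p (\<kappa> (n, k)) * c (n, k)) *\<^sub>C torus_monomial U (\<kappa> (n, k)))
          has_sum fourier U (\<lambda>k. p k * A n k) /\<^sub>R fact n) UNIV"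
        by (simp add: \<kappa>_def c_def scaleR_scaleC scaleC_scaleC mult_ac)
    qed
    then show ?thesis
      by (rule has_sum_imp_sums)
  qed
  have "(\<lambda>n. f ^ n /\<^sub>R fact n) sums fourier U E"
    using sums[of "\<lambda>_. 1" 1 0] by (simp add: A(2))
  then have "exp f = fourier U E"
    using exp_converges[of f] sums_unique2 by blast
  moreover have "rapidly_decreasing E"
    unfolding E_def by (rule rapidly_decreasing_fiber_sum[OF rapid])
  ultimately show ?thesis
    using sums by (intro exI[of _ E] conjI allI impI) auto
qed

lemma smooth_torus_scaleC:
  assumes "x \<in> smooth_torus U"
  shows "c *\<^sub>C x \<in> smooth_torus U"
proof -
  obtain a where a: "rapidly_decreasing a" "x = fourier U a"
    using assms by (auto simp: smooth_torus_def)
  have "rapidly_decreasing (\<lambda>k. c * a k)"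
    by (rule rapidly_decreasing_multiplier[OF a(1), of _ "cmod c" 0]) simp
  moreover have "fourier U (\<lambda>k. c * a k) = c *\<^sub>C x"
    using has_sum_bounded_linear[OF bounded_linear_scaleC_right fourier_has_sum[OF U a(1)], of c]
    by (simp add: fourier_def[of U "\<lambda>k. c * a k"] a(2) infsumI scaleC_scaleC)
  ultimately show ?thesis
    unfolding smooth_torus_def by (metis (mono_tags, lifting) imageI mem_Collect_eq)
qed

section \<open>The canonical derivations as Fourier multipliers\<close>

lemma torus_monomial_axis: "torus_monomial U (axis j n) = upow (U j) n"
  using exhaust_4[of j] by (auto simp: torus_monomial_def axis_def)

lemma upow_generator_smooth: "upow (U j) n \<in> smooth_torus U"
  using torus_monomial_smooth[OF U, of "axis j n"] by (simp add: torus_monomial_axis)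

lemma generator_smooth: "U j \<in> smooth_torus U" "star (U j) \<in> smooth_torus U"
  using upow_generator_smooth[of j 1] upow_generator_smooth[of j "-1"] by (simp_all add: upow_def)

context
  fixes j :: 4 and D :: "'a \<Rightarrow> 'a"
  assumes D: "canonical_derivation U j D"
begin

lemma derivation_smooth: "x \<in> smooth_torus U \<Longrightarrow> D x \<in> smooth_torus U"
  and derivation_add: "x \<in> smooth_torus U \<Longrightarrow> y \<in> smooth_torus U \<Longrightarrow> D (x + y) = D x + D y"
  and derivation_scaleC: "x \<in> smooth_torus U \<Longrightarrow> D (c *\<^sub>C x) = c *\<^sub>C D x"
  and derivation_mult: "x \<in> smooth_torus U \<Longrightarrow> y \<in> smooth_torus U \<Longrightarrow> D (x * y) = D x * y + x * D y"
  and derivation_generator: "D (U i) = (if j = i then 2 * pi * \<i> else 0) *\<^sub>C U i"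
  using D unfolding canonical_derivation_def by auto

lemma derivation_1: "D 1 = 0"
  using derivation_mult[OF smooth_torus_1[OF U] smooth_torus_1[OF U]] by simp

lemma derivation_eigen_mult:
  assumes "x \<in> smooth_torus U" "y \<in> smooth_torus U" "D x = z *\<^sub>C x" "D y = w *\<^sub>C y"
  shows "D (x * y) = (z + w) *\<^sub>C (x * y)"
  using assms by (simp add: derivation_mult mult_scaleC_left mult_scaleC_right scaleC_add_left)

lemma derivation_eigen_power:
  assumes "x \<in> smooth_torus U" "D x = z *\<^sub>C x"
  shows "D (x ^ n) = (of_nat n * z) *\<^sub>C x ^ n"
proof (induction n)
  case (Suc n)
  then show ?case
    using derivation_eigen_mult[OF assms(1) smooth_torus_power[OF U assms(1)] assms(2) Suc]
    by (simp add: algebra_simps)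
qed (simp add: derivation_1)

text \<open>
  Apply \<open>D\<close> to \<open>u * star u = 1\<close>.
\<close>

lemma derivation_eigen_star:
  assumes u: "unitary u" "u \<in> smooth_torus U" "star u \<in> smooth_torus U" "D u = z *\<^sub>C u"
  shows "D (star u) = (- z) *\<^sub>C star u"
proof -
  have "z *\<^sub>C 1 + u * D (star u) = 0"
    using derivation_mult[OF u(2,3)] u(1,4) by (simp add: unitary_def derivation_1 mult_scaleC_left)
  then have "u * D (star u) = (- z) *\<^sub>C 1"
    using scaleC_add_left[of z "- z" "1 :: 'a"] by (simp add: add_eq_0_iff)
  then have "star u * (u * D (star u)) = (- z) *\<^sub>C star u"
    by (simp add: mult_scaleC_right)
  then show ?thesis
    using u(1) by (simp add: unitary_def mult.assoc[symmetric])
qed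

lemma derivation_upow:
  "D (upow (U i) n) = (of_int n * (if j = i then 2 * pi * \<i> else 0)) *\<^sub>C upow (U i) n"
proof (cases "0 \<le> n")
  case True
  then show ?thesis
    using derivation_eigen_power[OF generator_smooth(1) derivation_generator, of i "nat n"]
    by (simp add: upow_def)
next
  case False
  then show ?thesis
    using derivation_eigen_power[OF generator_smooth(2) derivation_eigen_star[OF
          unitary_generator[OF U] generator_smooth derivation_generator], of i "nat (- n)"]
    by (simp add: upow_def)
qed

lemma derivation_torus_monomial:
  "D (torus_monomial U k) = (symbol j k) *\<^sub>C torus_monomial U k"
proof -
  let ?z = "\<lambda>i. of_int (k $ i) * (if j = i then 2 * pi * \<i> else 0)"
  have "D (torus_monomial U k) = (?z 1 + ?z 2 + ?z 3 + ?z 4) *\<^sub>C torus_monomial U k"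
    unfolding torus_monomial_def
    by (intro derivation_eigen_mult derivation_upow upow_generator_smooth smooth_torus_mult[OF U])
  also have "?z 1 + ?z 2 + ?z 3 + ?z 4 = symbol j k"
    unfolding symbol_def using exhaust_4[of j] by auto
  finally show ?thesis .
qed

lemma derivation_finite_sum:
  assumes "finite F"
  shows "(\<Sum>k\<in>F. a k *\<^sub>C torus_monomial U k) \<in> smooth_torus U
    \<and> D (\<Sum>k\<in>F. a k *\<^sub>C torus_monomial U k)
      = (\<Sum>k\<in>F. (symbol j k * a k) *\<^sub>C torus_monomial U k)"
  using assms
proof (induction F rule: finite_induct)
  case empty
  have "0 \<in> smooth_torus U" "D 0 = 0"
    using smooth_torus_scaleC[OF smooth_torus_1[OF U], of 0] derivation_scaleC[OF smooth_torus_1[OF U], of 0]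
    by simp_all
  then show ?case by simp
next
  case (insert k F)
  then show ?case
    by (simp add: derivation_add smooth_torus_add[OF U] smooth_torus_scaleC torus_monomial_smooth[OF U]
        derivation_scaleC derivation_torus_monomial scaleC_scaleC mult_ac)
qed

text \<open>
  Sup-seminorms of the tails are dominated by tails of a convergent series, hence tend to 0. So
  finite partial sums approximate a smooth element in the Frechet topology.
\<close>

lemma decay_seminorm_tail_le:
  assumes a: "rapidly_decreasing a" and F: "finite F"
  shows "0 \<le> decay_seminorm N (\<lambda>k. if k \<in> F then 0 else a k)" (is ?A)
    and "decay_seminorm N (\<lambda>k. if k \<in> F then 0 else a k)
      \<le> (\<Sum>\<^sub>\<infinity>k. decay_weight N a k) - (\<Sum>k\<in>F. decay_weight N a k)" (is ?B)
proof -
  let ?r = "\<lambda>k. if k \<in> F then 0 else a k" and ?T = "\<Sum>\<^sub>\<infinity>k. decay_weight N a k"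
  have sum: "decay_weight N a summable_on UNIV"
    using a by (simp add: rapidly_decreasing_iff_rapid_family rapid_family_def decay_weight_eq[abs_def])
  have partial: "(\<Sum>k\<in>G. decay_weight N a k) \<le> ?T" if "finite G" for G
    by (rule finite_sum_le_infsum[OF sum that]) (auto simp: decay_weight_eq weight_nonneg)
  have le: "decay_weight N ?r k \<le> ?T - (\<Sum>k\<in>F. decay_weight N a k)" for k
  proof (cases "k \<in> F")
    case True
    then show ?thesis
      using partial[OF F] by (simp add: decay_weight_eq)
  next
    case False
    then show ?thesis
      using partial[of "insert k F"] F by (simp add: decay_weight_eq)
  qed
  then show ?B
    unfolding decay_seminorm_def by (intro cSUP_least) auto
  have "0 \<le> decay_weight N ?r 0"
    by (simp add: decay_weight_eq weight_nonneg)
  also have "\<dots> \<le> decay_seminorm N ?r"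
    unfolding decay_seminorm_def by (rule cSUP_upper) (use le in \<open>auto intro!: bdd_aboveI2\<close>)
  finally show ?A .
qed

text \<open>
  On finite sums the formula holds by linearity. The continuity bound, applied to the tail, shows
  that the images of the finite partial sums converge to \<open>D (fourier U a)\<close>; they also converge to the right
  hand side.
\<close>

lemma derivation_fourier:
  assumes a: "rapidly_decreasing a"
  shows "D (fourier U a) = fourier U (\<lambda>k. symbol j k * a k)"
proof -
  obtain N C where cont: "\<And>a. rapidly_decreasing a \<Longrightarrow> norm (D (fourier U a)) \<le> C * decay_seminorm N a"
    using D unfolding canonical_derivation_def by blast
  let ?S = "\<lambda>F. \<Sum>k\<in>F. (symbol j k * a k) *\<^sub>C torus_monomial U k"
  let ?e = "\<lambda>F. \<bar>C\<bar> * ((\<Sum>\<^sub>\<infinity>k. decay_weight N a k) - (\<Sum>k\<in>F. decay_weight N a k))"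
  have bound: "norm (?S F - D (fourier U a)) \<le> ?e F" if F: "finite F" for F
  proof -
    \<comment> \<open>The partial sum over \<open>F\<close> and the tail.\<close>
    let ?h = "\<lambda>k. if k \<in> F then a k else 0" and ?r = "\<lambda>k. if k \<in> F then 0 else a k"
    have h: "rapidly_decreasing ?h"
      by (rule rapidly_decreasing_finite_support[OF F]) simp
    have r: "rapidly_decreasing ?r"
      using rapidly_decreasing_multiplier[OF a, of "\<lambda>k. if k \<in> F then 0 else 1" 1 0]
      by (simp add: if_distrib[of "\<lambda>c. c * _"] cong: if_cong)
    have "fourier U ?h = (\<Sum>k\<in>F. a k *\<^sub>C torus_monomial U k)"
      by (subst fourier_finite_support[OF U F]) auto
    then have Dh: "D (fourier U ?h) = ?S F"
      using derivation_finite_sum[OF F, of a] by simp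
    have "fourier U a = fourier U (\<lambda>k. ?h k + ?r k)"
      by (rule arg_cong[where f = "fourier U"]) auto
    also have "\<dots> = fourier U ?h + fourier U ?r"
      by (rule fourier_add[OF U h r])
    finally have "D (fourier U a) = ?S F + D (fourier U ?r)"
      using h r Dh by (simp add: derivation_add smooth_torus_def)
    then have "norm (?S F - D (fourier U a)) = norm (D (fourier U ?r))"
      by (simp add: norm_minus_commute)
    also have "\<dots> \<le> C * decay_seminorm N ?r"
      by (rule cont[OF r])
    also have "\<dots> \<le> \<bar>C\<bar> * decay_seminorm N ?r"
      by (intro mult_right_mono decay_seminorm_tail_le(1) a F) simp
    also have "\<dots> \<le> ?e F"
      by (intro mult_left_mono decay_seminorm_tail_le(2) a F) simp
    finally show ?thesis .
  qed
  have "decay_weight N a summable_on UNIV"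
    using a by (simp add: rapidly_decreasing_iff_rapid_family rapid_family_def decay_weight_eq[abs_def])
  then have "(sum (decay_weight N a) \<longlongrightarrow> (\<Sum>\<^sub>\<infinity>k. decay_weight N a k)) (finite_subsets_at_top UNIV)"
    by (rule infsum_tendsto)
  then have "(?e \<longlongrightarrow> \<bar>C\<bar> * ((\<Sum>\<^sub>\<infinity>k. decay_weight N a k) - (\<Sum>\<^sub>\<infinity>k. decay_weight N a k))) (finite_subsets_at_top UNIV)"
    by (intro tendsto_intros)
  then have "(?e \<longlongrightarrow> 0) (finite_subsets_at_top UNIV)"
    by simp
  then have "((\<lambda>F. ?S F - D (fourier U a)) \<longlongrightarrow> 0) (finite_subsets_at_top UNIV)"
    by (rule Lim_null_comparison[rotated]) (rule eventually_finite_subsets_at_top_weakI, rule bound)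
  then have "((\<lambda>k. (symbol j k * a k) *\<^sub>C torus_monomial U k) has_sum D (fourier U a)) UNIV"
    unfolding has_sum_def by (rule LIM_zero_cancel)
  then show ?thesis
    by (simp add: fourier_def infsumI)
qed

text \<open>
  \<open>D\<close> and \<open>D \<circ> D\<close> act on Fourier coefficients as multipliers of polynomial growth.
\<close>

lemma derivatives_of_exp_termwise:
  assumes f: "f \<in> smooth_torus U"
  shows "(\<lambda>n. D (f ^ n) /\<^sub>R fact n) sums D (exp f)"
    and "(\<lambda>n. D (D (f ^ n)) /\<^sub>R fact n) sums D (D (exp f))"
proof -
  obtain a where a: "rapidly_decreasing a" "f = fourier U a"
    using f by (auto simp: smooth_torus_def)
  obtain A where A: "\<And>n. rapidly_decreasing (A n)" "\<And>n. fourier U (A n) = fourier U a ^ n"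
    "\<And>n N. (\<Sum>\<^sub>\<infinity>k. weight k ^ N * cmod (A n k)) \<le> (\<Sum>\<^sub>\<infinity>k. weight k ^ N * cmod (a k)) ^ n"
    using fourier_powers_exist[OF a(1)] by blast
  obtain E where E: "rapidly_decreasing E" "exp (fourier U a) = fourier U E"
    "\<forall>p C M. (\<forall>k. cmod (p k) \<le> C * weight k ^ M) \<longrightarrow>
      (\<lambda>n. fourier U (\<lambda>k. p k * A n k) /\<^sub>R fact n) sums fourier U (\<lambda>k. p k * E k)"
    using exp_fourier_expansion[OF A] by blast
  have D1: "D (fourier U b) = fourier U (\<lambda>k. symbol j k * b k)" if "rapidly_decreasing b" for b
    by (rule derivation_fourier[OF that])
  have D2: "D (D (fourier U b)) = fourier U (\<lambda>k. symbol j k * symbol j k * b k)" if "rapidly_decreasing b" for b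
    using D1[OF rapidly_decreasing_multiplier[OF that symbol_growth]] D1[OF that]
    by (simp add: mult.assoc)
  have growth2: "cmod (symbol j k * symbol j k) \<le> (2 * pi)^2 * weight k ^ 2" for k
    using mult_mono[OF symbol_growth[of j k] symbol_growth[of j k]] weight_nonneg[of k]
    by (simp add: norm_mult power2_eq_square mult_ac)
  show "(\<lambda>n. D (f ^ n) /\<^sub>R fact n) sums D (exp f)"
    using E(3)[rule_format, OF symbol_growth] unfolding a(2) E(2) D1[OF E(1)] A(2)[symmetric] D1[OF A(1)] .
  show "(\<lambda>n. D (D (f ^ n)) /\<^sub>R fact n) sums D (D (exp f))"
    using E(3)[rule_format, OF growth2] unfolding a(2) E(2) D2[OF E(1)] A(2)[symmetric] D2[OF A(1)] .
qed

lemma derivatives_of_exp: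
  assumes f: "f \<in> smooth_torus U"
  shows "D (exp f) = exp f * K_nabla f (D f)"
    and "D (D (exp f)) = exp f * (K_nabla f (D (D f))
      + 2 *\<^sub>R fps_at_1 (fps_antideriv (conj_fps f (D f) * fps_antideriv (conj_fps f (D f)))))"
proof -
  note S = f derivation_smooth smooth_torus_power[OF U] smooth_torus_mult[OF U]
  have D_Suc: "D (f ^ Suc n) = D f * f ^ n + f * D (f ^ n)" for n
    by (simp add: derivation_mult S)
  have DD_Suc: "D (D (f ^ Suc n)) = D (D f) * f ^ n + 2 * (D f * D (f ^ n)) + f * D (D (f ^ n))" for n
    unfolding D_Suc by (simp add: derivation_mult derivation_add S mult_2)
  have 0: "D (f ^ 0) = 0" "D (D (f ^ 0)) = 0"
    using derivation_scaleC[OF smooth_torus_1[OF U], of 0] by (simp_all add: derivation_1)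
  show "D (exp f) = exp f * K_nabla f (D f)"
    using derivatives_of_exp_termwise(1)[OF f]
      derivatives_of_exp_sums(1)[where d = "\<lambda>n. D (f ^ n)" and e = "\<lambda>n. D (D (f ^ n))", OF 0(1) D_Suc 0(2) DD_Suc]
    by (rule sums_unique2)
  show "D (D (exp f)) = exp f * (K_nabla f (D (D f))
      + 2 *\<^sub>R fps_at_1 (fps_antideriv (conj_fps f (D f) * fps_antideriv (conj_fps f (D f)))))"
    using derivatives_of_exp_termwise(2)[OF f]
      derivatives_of_exp_sums(2)[where d = "\<lambda>n. D (f ^ n)" and e = "\<lambda>n. D (D (f ^ n))", OF 0(1) D_Suc 0(2) DD_Suc]
    by (rule sums_unique2)
qed

end

end

section \<open>The scalar curvature\<close>

theorem proposition3p5: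
  fixes \<Theta> :: "real^4^4"
    and U :: "4 \<Rightarrow> 'a::cstar_algebra"
    and \<delta> :: "4 \<Rightarrow> 'a \<Rightarrow> 'a"
    and f :: 'a
  assumes "transpose \<Theta> = - \<Theta>"
    and "is_nc_torus \<Theta> U"
    and "\<And>j. canonical_derivation U j (\<delta> j)"
    and "f \<in> smooth_torus U" and "star f = f"
  shows "scalar_curvature \<delta> f =
    - 3 * exp (- f) * K_nabla f (\<Sum>i\<in>UNIV. \<delta> i (\<delta> i f))
    + 3 * exp (- f) * (\<Sum>i\<in>UNIV. H_nabla f (\<delta> i f) (\<delta> i f))"
proof -
  have U: "torus_unitaries \<Theta> U"
    using assms(2) by (simp add: is_nc_torus_def)
  note d = derivatives_of_exp[OF U assms(3) assms(4)]
  have cancel: "exp (- f) * (exp f * x) = x" for x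
    by (simp add: mult.assoc[symmetric] exp_minus_inverse exp_add_commuting[symmetric])
  have two: "exp (- 2 * f) = exp (- f) * exp (- f)"
    by (simp add: exp_add_commuting[symmetric] mult_2)
  have summand: "- 3 * exp (- 2 * f) * \<delta> i (\<delta> i (exp f))
      + (3/2) *\<^sub>R (exp (- 2 * f) * \<delta> i (exp f) * exp (- f) * \<delta> i (exp f))
    = - 3 * exp (- f) * K_nabla f (\<delta> i (\<delta> i f)) + 3 * exp (- f) * H_nabla f (\<delta> i f) (\<delta> i f)" for i
  proof -
    define Q where "Q = fps_at_1 (fps_antideriv (conj_fps f (\<delta> i f) * fps_antideriv (conj_fps f (\<delta> i f))))"
    define A where "A = K_nabla f (\<delta> i f)"
    define B where "B = K_nabla f (\<delta> i (\<delta> i f))"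
    have second: "exp (- 2 * f) * \<delta> i (\<delta> i (exp f)) = exp (- f) * (B + 2 *\<^sub>R Q)"
      unfolding d(2) two B_def[symmetric] Q_def[symmetric] by (simp add: mult.assoc cancel)
    have first: "exp (- 2 * f) * \<delta> i (exp f) * exp (- f) * \<delta> i (exp f) = exp (- f) * (A * A)"
      unfolding d two A_def[symmetric] by (simp add: mult.assoc cancel)
    have H: "H_nabla f (\<delta> i f) (\<delta> i f) = (1/2) *\<^sub>R (A * A) - 2 *\<^sub>R Q"
      unfolding H_nabla_eq A_def Q_def ..
    have three: "3 * x = 3 *\<^sub>R x" "- 3 * x = - (3 *\<^sub>R x)" for x :: 'a
      by (simp_all add: scaleR_conv_of_real)
    show ?thesis
      unfolding mult.assoc[of "- 3"] mult.assoc[of 3] second first H B_def[symmetric]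
      unfolding three
      by (simp add: algebra_simps)
  qed
  show ?thesis
    unfolding scalar_curvature_def summand sum.distrib K_nabla_sum sum_distrib_left by simp
qed

end
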